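(* Let $p$ be a prime and let $m,n$ be positive integers such that $p$ does not divide both $m$ and $n$. Write $d=\gcd(m,n)$, let $N$ be the number of pairs $(x,y)\in\mathbf{F}_p\times\mathbf{F}_p$ with $x^n+y^m=0$ in $\mathbf{F}_p$, and for a complex number $s$ with $\operatorname{Re}(s)>0$ put $t=p^{-s}$. Then $$\int_{\mathbf{Z}_p^2}|x^n+y^m|_p^s\,dx\,dy=\frac{(1-p^{-1})p^{-1}}{1-p^{-\frac{m+n}{d}}t^{\frac{mn}{d}}}\left[\sum_{j=0}^{\frac{n}{d}-1}p^{-\lfloor jm/n\rfloor-j}\,t^{mj}+\sum_{j=0}^{\frac{m}{d}-1}p^{-\lfloor jn/m\rfloor-j}\,t^{nj}\right]$$ $$\qquad+\frac{\left[(p-1)^2-(N-1)\right]p^{-2}(1-p^{-1}t)+(N-1)(p^2-p)p^{-4}t}{(1-p^{-1}t)\left(1-p^{-\frac{m+n}{d}}t^{\frac{mn}{d}}\right)}.$$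
   Context: $\mathbf{Z}_p$ denotes the ring of $p$-adic integers, $|\cdot|_p$ the $p$-adic absolute value normalized by $|p|_p=p^{-1}$, and $dx\,dy$ the product on $\mathbf{Z}_p^2$ of the Haar measure normalized so that $\mathbf{Z}_p$ has measure $1$. For a nonnegative real number $a=|x^n+y^m|_p$, $a^s$ means $e^{s\log a}$ if $a>0$ and $0$ if $a=0$. $\mathbf{F}_p$ is the field with $p$ elements and $\lfloor\cdot\rfloor$ is the floor function. *)

theory Defs
  imports "HOL-Probability.Probability" "HOL-Number_Theory.Residues"
begin

section \<open>The ring of p-adic integers\<close>

text \<open>
  The p-adic integers are the inverse limit of the rings \<open>Z/p^k\<close>: an element is the sequence of its
  residues modulo \<open>p^k\<close>, each residue being represented in \<open>{0..<p^k}\<close>.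
\<close>

definition Zp :: "nat \<Rightarrow> (nat \<Rightarrow> int) ring" where
  "Zp p =
    \<lparr>carrier = {x. \<forall>k. x k \<in> {0..<int p ^ k} \<and> x (Suc k) mod int p ^ k = x k},
     monoid.mult = (\<lambda>x y k. (x k * y k) mod int p ^ k),
     one = (\<lambda>k. 1 mod int p ^ k),
     zero = (\<lambda>k. 0),
     add = (\<lambda>x y k. (x k + y k) mod int p ^ k)\<rparr>"

text \<open>\<open>x k = 0\<close> means that \<open>x\<close> is divisible by \<open>p^k\<close>; see \<open>Zp_divides_iff\<close> below.\<close>

definition padic_ord :: "(nat \<Rightarrow> int) \<Rightarrow> nat" where
  "padic_ord x = (GREATEST k. x k = 0)"

definition padic_abs :: "nat \<Rightarrow> (nat \<Rightarrow> int) \<Rightarrow> real" where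
  "padic_abs p x = (if x = \<zero>\<^bsub>Zp p\<^esub> then 0 else 1 / real p ^ padic_ord x)"

text \<open>The locale \<open>Metric_space\<close> requires symmetry also outside the carrier, whence the case distinction.\<close>

definition padic_dist :: "nat \<Rightarrow> (nat \<Rightarrow> int) \<Rightarrow> (nat \<Rightarrow> int) \<Rightarrow> real" where
  "padic_dist p x y =
     (if x \<in> carrier (Zp p) \<and> y \<in> carrier (Zp p) then padic_abs p (x \<ominus>\<^bsub>Zp p\<^esub> y) else 0)"

definition Zp_borel :: "nat \<Rightarrow> (nat \<Rightarrow> int) measure" where
  "Zp_borel p = sigma (carrier (Zp p))
     {U. openin (Metric_space.mtopology (carrier (Zp p)) (padic_dist p)) U}"

definition normalized_haar :: "nat \<Rightarrow> (nat \<Rightarrow> int) measure \<Rightarrow> bool" where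
  "normalized_haar p M \<longleftrightarrow>
     sets M = sets (Zp_borel p) \<and>
     emeasure M (carrier (Zp p)) = 1 \<and>
     (\<forall>a \<in> carrier (Zp p). \<forall>A \<in> sets M.
        emeasure M ((\<lambda>x. a \<oplus>\<^bsub>Zp p\<^esub> x) ` A) = emeasure M A)"

text \<open>Existence and uniqueness are proved below in \<open>ex1_normalized_haar\<close>.\<close>

definition Zp_haar :: "nat \<Rightarrow> (nat \<Rightarrow> int) measure" where
  "Zp_haar p = (THE M. normalized_haar p M)"

section \<open>Ring structure, metric, and existence and uniqueness of the Haar measure\<close>

context
  fixes p :: nat
  assumes p: "p > 1"
begin

lemma Zp_simps:
  "carrier (Zp p) = {x. \<forall>k. x k \<in> {0..<int p ^ k} \<and> x (Suc k) mod int p ^ k = x k}"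
  "x \<otimes>\<^bsub>Zp p\<^esub> y = (\<lambda>k. (x k * y k) mod int p ^ k)"
  "x \<oplus>\<^bsub>Zp p\<^esub> y = (\<lambda>k. (x k + y k) mod int p ^ k)"
  "\<one>\<^bsub>Zp p\<^esub> = (\<lambda>k. 1 mod int p ^ k)"
  "\<zero>\<^bsub>Zp p\<^esub> = (\<lambda>k. 0)"
  by (simp_all add: Zp_def)

lemma Zp_bounds: "x \<in> carrier (Zp p) \<Longrightarrow> 0 \<le> x k \<and> x k < int p ^ k"
  by (auto simp: Zp_simps)

lemma Zp_mod_self: "x \<in> carrier (Zp p) \<Longrightarrow> x k mod int p ^ k = x k"
  using Zp_bounds[of x k] by simp

lemma Zp_mod:
  assumes x: "x \<in> carrier (Zp p)" and "j \<le> k"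
  shows "x k mod int p ^ j = x j"
  using \<open>j \<le> k\<close>
proof (induction k rule: dec_induct)
  case base
  show ?case using Zp_mod_self[OF x] .
next
  case (step k)
  have "x (Suc k) mod int p ^ j = x (Suc k) mod int p ^ k mod int p ^ j"
    using step by (simp add: le_imp_power_dvd mod_mod_cancel)
  also have "\<dots> = x j"
    using x step by (auto simp: Zp_simps)
  finally show ?case .
qed

lemma Zp_memI:
  assumes "\<And>k. f (Suc k) mod int p ^ k = f k mod int p ^ k"
  shows "(\<lambda>k. f k mod int p ^ k) \<in> carrier (Zp p)"
proof -
  have "f (Suc k) mod int p ^ Suc k mod int p ^ k = f k mod int p ^ k" for k
    using assms[of k] by (metis le_imp_power_dvd lessI less_imp_le mod_mod_cancel)
  then show ?thesis using p by (auto simp: Zp_simps)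
qed

lemma Zp_Suc: "x \<in> carrier (Zp p) \<Longrightarrow> x (Suc k) mod int p ^ k = x k mod int p ^ k"
  using Zp_mod[of x k "Suc k"] Zp_mod_self[of x k] by simp

lemma Zp_add_closed:
  assumes "x \<in> carrier (Zp p)" "y \<in> carrier (Zp p)"
  shows "x \<oplus>\<^bsub>Zp p\<^esub> y \<in> carrier (Zp p)"
  unfolding Zp_simps(3) using assms by (intro Zp_memI mod_add_cong Zp_Suc)

lemma Zp_mult_closed:
  assumes "x \<in> carrier (Zp p)" "y \<in> carrier (Zp p)"
  shows "x \<otimes>\<^bsub>Zp p\<^esub> y \<in> carrier (Zp p)"
  unfolding Zp_simps(2) using assms by (intro Zp_memI mod_mult_cong Zp_Suc)

lemma Zp_one_closed: "\<one>\<^bsub>Zp p\<^esub> \<in> carrier (Zp p)"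
  unfolding Zp_simps(4) by (intro Zp_memI) simp

lemma Zp_zero_closed: "\<zero>\<^bsub>Zp p\<^esub> \<in> carrier (Zp p)"
  using p by (simp add: Zp_simps)

lemma Zp_neg_closed:
  assumes "x \<in> carrier (Zp p)"
  shows "(\<lambda>k. - x k mod int p ^ k) \<in> carrier (Zp p)"
  using assms by (intro Zp_memI mod_minus_cong Zp_Suc)

lemma cring_Zp: "cring (Zp p)"
proof (rule cringI)
  show "abelian_group (Zp p)"
  proof (rule abelian_groupI)
    fix x assume x: "x \<in> carrier (Zp p)"
    show "\<zero>\<^bsub>Zp p\<^esub> \<oplus>\<^bsub>Zp p\<^esub> x = x"
      by (simp add: Zp_simps(3,5) Zp_mod_self[OF x])
    show "\<exists>y\<in>carrier (Zp p). y \<oplus>\<^bsub>Zp p\<^esub> x = \<zero>\<^bsub>Zp p\<^esub>"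
      by (rule bexI[OF _ Zp_neg_closed[OF x]]) (simp add: Zp_simps(3,5) mod_add_left_eq)
  qed (rule Zp_add_closed Zp_zero_closed | assumption |
       simp add: Zp_simps(3) mod_simps algebra_simps)+
  show "Group.comm_monoid (Zp p)"
  proof (rule comm_monoidI)
    fix x assume x: "x \<in> carrier (Zp p)"
    show "\<one>\<^bsub>Zp p\<^esub> \<otimes>\<^bsub>Zp p\<^esub> x = x"
      by (simp add: Zp_simps(2,4) mod_mult_left_eq Zp_mod_self[OF x])
  qed (rule Zp_mult_closed Zp_one_closed | assumption |
       simp add: Zp_simps(2) mod_simps algebra_simps)+
qed (auto simp: Zp_simps(2,3) mod_simps algebra_simps)

lemma Zp_a_inv:
  assumes x: "x \<in> carrier (Zp p)"
  shows "\<ominus>\<^bsub>Zp p\<^esub> x = (\<lambda>k. - x k mod int p ^ k)"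
proof -
  interpret cring "Zp p" by (rule cring_Zp)
  have "(\<lambda>k. - x k mod int p ^ k) \<oplus>\<^bsub>Zp p\<^esub> x = \<zero>\<^bsub>Zp p\<^esub>"
    by (simp add: Zp_simps(3,5) mod_add_left_eq)
  then show ?thesis using minus_equality x Zp_neg_closed[OF x] by blast
qed

lemma Zp_minus:
  assumes "y \<in> carrier (Zp p)"
  shows "x \<ominus>\<^bsub>Zp p\<^esub> y = (\<lambda>k. (x k - y k) mod int p ^ k)"
  using assms by (simp add: a_minus_def Zp_a_inv Zp_simps(3) mod_add_right_eq)

lemma Zp_minus_eq_0_iff:
  assumes "x \<in> carrier (Zp p)" "y \<in> carrier (Zp p)"
  shows "(x \<ominus>\<^bsub>Zp p\<^esub> y) k = 0 \<longleftrightarrow> x k = y k"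
  using Zp_mod_self[OF assms(1), of k] Zp_mod_self[OF assms(2), of k]
    mod_eq_dvd_iff[of "x k" "int p ^ k" "y k"]
  by (simp add: Zp_minus[OF assms(2)] mod_eq_0_iff_dvd)

lemma Zp_pow_p: "add_pow (Zp p) (p ^ k) \<one>\<^bsub>Zp p\<^esub> = (\<lambda>j. int p ^ k mod int p ^ j)"
proof -
  interpret cring "Zp p" by (rule cring_Zp)
  have "add_pow (Zp p) (c::nat) \<one>\<^bsub>Zp p\<^esub> = (\<lambda>j. int c mod int p ^ j)" for c
    by (induction c) (simp_all add: Zp_simps(3-5) mod_simps algebra_simps)
  then show ?thesis by simp
qed

lemma Zp_divides_iff:
  assumes x: "x \<in> carrier (Zp p)"
  shows "(\<exists>y \<in> carrier (Zp p). x = add_pow (Zp p) (p ^ k) \<one>\<^bsub>Zp p\<^esub> \<otimes>\<^bsub>Zp p\<^esub> y) \<longleftrightarrow> x k = 0"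
proof
  assume "(\<exists>y \<in> carrier (Zp p). x = add_pow (Zp p) (p ^ k) \<one>\<^bsub>Zp p\<^esub> \<otimes>\<^bsub>Zp p\<^esub> y)"
  then show "x k = 0"
    by (auto simp: Zp_pow_p Zp_simps(2))
next
  assume x0: "x k = 0"
  define y where "y j = x (j + k) div int p ^ k" for j
  have dv: "int p ^ k dvd x (j + k)" for j
    using Zp_mod[OF x, of k "j + k"] x0 by auto
  have "y \<in> carrier (Zp p)"
  proof -
    have "0 \<le> y j" for j
      using Zp_bounds[OF x] p by (simp add: y_def pos_imp_zdiv_nonneg_iff)
    moreover have "y j < int p ^ j" for j
    proof -
      have "int p ^ k * y j < int p ^ k * int p ^ j"
        using Zp_bounds[OF x, of "j + k"] dv[of j] by (simp add: y_def power_add mult.commute)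
      then show ?thesis using p by simp
    qed
    moreover have "y (Suc j) mod int p ^ j = y j" for j
    proof -
      have "x (Suc j + k) mod (int p ^ k * int p ^ j) = x (j + k)"
        using Zp_mod[OF x, of "j + k" "Suc j + k"] by (simp add: power_add mult.commute)
      moreover have "x (Suc j + k) = int p ^ k * y (Suc j)" "x (j + k) = int p ^ k * y j"
        using dv by (simp_all only: y_def dvd_mult_div_cancel)
      ultimately show ?thesis using p by (simp add: mult_mod_right[symmetric])
    qed
    ultimately show ?thesis by (auto simp: Zp_simps)
  qed
  moreover have "x = (add_pow (Zp p) (p ^ k) \<one>\<^bsub>Zp p\<^esub>) \<otimes>\<^bsub>Zp p\<^esub> y"
  proof
    fix j
    have "(int p ^ k * y j) mod int p ^ j = x (j + k) mod int p ^ j"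
      using dv[of j] by (simp add: y_def)
    also have "\<dots> = x j" by (rule Zp_mod[OF x]) simp
    finally show "x j = ((add_pow (Zp p) (p ^ k) \<one>\<^bsub>Zp p\<^esub>) \<otimes>\<^bsub>Zp p\<^esub> y) j"
      unfolding Zp_pow_p Zp_simps(2) by (simp add: mod_mult_left_eq)
  qed
  ultimately show "(\<exists>y \<in> carrier (Zp p). x = add_pow (Zp p) (p ^ k) \<one>\<^bsub>Zp p\<^esub> \<otimes>\<^bsub>Zp p\<^esub> y)"
    by blast
qed

lemma padic_ord:
  assumes x: "x \<in> carrier (Zp p)" and nz: "x \<noteq> \<zero>\<^bsub>Zp p\<^esub>"
  shows "x k = 0 \<longleftrightarrow> k \<le> padic_ord x"
proof -
  obtain b where b: "x b \<noteq> 0" using nz by (auto simp: Zp_simps)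
  have mono: "x j = 0" if "j \<le> k" "x k = 0" for j k
    using Zp_mod[OF x that(1)] that(2) by simp
  have bd: "x j = 0 \<Longrightarrow> j \<le> b" for j
    using mono[of b j] b by force
  have "x 0 = 0" using Zp_bounds[OF x, of 0] by simp
  then have 1: "x (padic_ord x) = 0"
    unfolding padic_ord_def using bd by (rule GreatestI_nat)
  have 2: "j \<le> padic_ord x" if "x j = 0" for j
    unfolding padic_ord_def using that bd by (rule Greatest_le_nat)
  show ?thesis using 1 2 mono by blast
qed

lemma padic_abs_le_iff:
  assumes x: "x \<in> carrier (Zp p)"
  shows "padic_abs p x \<le> 1 / real p ^ k \<longleftrightarrow> x k = 0"
proof (cases "x = \<zero>\<^bsub>Zp p\<^esub>")
  case True
  then show ?thesis by (simp add: padic_abs_def Zp_simps)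
next
  case False
  then show ?thesis using padic_ord[OF x False, of k] p
    by (simp add: padic_abs_def field_simps)
qed

lemma padic_abs_nonneg: "0 \<le> padic_abs p x"
  by (simp add: padic_abs_def)

lemma padic_abs_mono:
  assumes "x \<in> carrier (Zp p)" "y \<in> carrier (Zp p)" "\<And>k. x k = 0 \<Longrightarrow> y k = 0"
  shows "padic_abs p y \<le> padic_abs p x"
proof (cases "x = \<zero>\<^bsub>Zp p\<^esub>")
  case True
  then have "y = \<zero>\<^bsub>Zp p\<^esub>" using assms(3) by (auto simp: Zp_simps)
  then show ?thesis by (simp add: True)
next
  case False
  have "y (padic_ord x) = 0" using padic_ord[OF assms(1) False] assms(3) by blast
  then have "padic_abs p y \<le> 1 / real p ^ padic_ord x"
    by (simp add: padic_abs_le_iff assms)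
  then show ?thesis using False by (simp add: padic_abs_def[of p x])
qed


lemma padic_dist_le_iff:
  assumes "x \<in> carrier (Zp p)" "y \<in> carrier (Zp p)"
  shows "padic_dist p x y \<le> 1 / real p ^ k \<longleftrightarrow> x k = y k"
proof -
  interpret cring "Zp p" by (rule cring_Zp)
  show ?thesis
    using assms by (simp add: padic_dist_def padic_abs_le_iff Zp_minus_eq_0_iff)
qed

lemma Metric_space_Zp: "Metric_space (carrier (Zp p)) (padic_dist p)"
proof -
  interpret cring "Zp p" by (rule cring_Zp)
  show ?thesis
  proof
    fix x y z
    show "0 \<le> padic_dist p x y" by (simp add: padic_dist_def padic_abs_nonneg)
    show "padic_dist p x y = padic_dist p y x"
    proof (cases "x \<in> carrier (Zp p) \<and> y \<in> carrier (Zp p)")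
      case True
      then have "padic_abs p (x \<ominus>\<^bsub>Zp p\<^esub> y) = padic_abs p (y \<ominus>\<^bsub>Zp p\<^esub> x)"
        by (intro order.antisym[of "padic_abs p _"] padic_abs_mono) (simp_all add: Zp_minus_eq_0_iff)
      then show ?thesis by (simp add: padic_dist_def)
    qed (auto simp: padic_dist_def)
    assume x: "x \<in> carrier (Zp p)" and y: "y \<in> carrier (Zp p)"
    show "padic_dist p x y = 0 \<longleftrightarrow> x = y"
      using x y p by (simp add: padic_dist_def padic_abs_def)
    assume z: "z \<in> carrier (Zp p)"
    have "padic_dist p x z \<le> padic_dist p x y"
      if ne: "x \<ominus>\<^bsub>Zp p\<^esub> z \<noteq> \<zero>\<^bsub>Zp p\<^esub>" and l2: "padic_dist p y z < padic_dist p x z"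
    proof (rule ccontr)
      assume "\<not> ?thesis"
      then have l: "padic_dist p x y < padic_dist p x z" by simp
      define k where "k = padic_ord (x \<ominus>\<^bsub>Zp p\<^esub> z)"
      have d: "padic_dist p x z = 1 / real p ^ k"
        using x z ne by (simp add: padic_dist_def padic_abs_def k_def)
      have aux: "a (Suc k) = b (Suc k)"
        if "a \<in> carrier (Zp p)" "b \<in> carrier (Zp p)" "padic_dist p a b < 1 / real p ^ k" for a b
      proof (cases "a \<ominus>\<^bsub>Zp p\<^esub> b = \<zero>\<^bsub>Zp p\<^esub>")
        case True
        then show ?thesis using that by simp
      next
        case False
        then have "1 / real p ^ padic_ord (a \<ominus>\<^bsub>Zp p\<^esub> b) < 1 / real p ^ k"
          using that by (simp add: padic_dist_def padic_abs_def)
        then have "k < padic_ord (a \<ominus>\<^bsub>Zp p\<^esub> b)"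
          using p by (simp add: field_simps)
        then have "(a \<ominus>\<^bsub>Zp p\<^esub> b) (Suc k) = 0"
          using padic_ord[OF _ False, of "Suc k"] that by simp
        then show ?thesis using that by (simp add: Zp_minus_eq_0_iff)
      qed
      have "x (Suc k) = z (Suc k)" using aux[OF x y] aux[OF y z] l l2 unfolding d by simp
      then have "(x \<ominus>\<^bsub>Zp p\<^esub> z) (Suc k) = 0" using x z by (simp add: Zp_minus_eq_0_iff)
      then show False
        using padic_ord[OF _ ne, of "Suc k"] x z by (simp add: k_def)
    qed
    moreover have "0 \<le> padic_dist p a b" for a b
      by (simp add: padic_dist_def padic_abs_nonneg)
    moreover have "padic_dist p x z = 0" if "x \<ominus>\<^bsub>Zp p\<^esub> z = \<zero>\<^bsub>Zp p\<^esub>"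
      using that by (simp add: padic_dist_def padic_abs_def)
    ultimately show "padic_dist p x z \<le> padic_dist p x y + padic_dist p y z"
      by (metis add_increasing add_increasing2 linorder_not_le order.strict_implies_order)
  qed
qed

definition ball_Zp :: "nat \<Rightarrow> int \<Rightarrow> (nat \<Rightarrow> int) set" where
  "ball_Zp k a = {x \<in> carrier (Zp p). x k = a}"

definition balls_Zp :: "(nat \<Rightarrow> int) set set" where
  "balls_Zp = insert {} {ball_Zp k a | k a. True}"

lemma balls_Zp_subset: "balls_Zp \<subseteq> Pow (carrier (Zp p))"
  by (auto simp: balls_Zp_def ball_Zp_def)

lemma countable_balls_Zp: "countable balls_Zp"
proof -
  have "{ball_Zp k a | k a. True} = (\<lambda>(k, a). ball_Zp k a) ` UNIV" by auto
  then show ?thesis by (simp add: balls_Zp_def)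
qed

lemma ball_Zp_in: "ball_Zp k a \<in> balls_Zp"
  by (auto simp: balls_Zp_def)

lemma Int_stable_balls_Zp: "Int_stable balls_Zp"
proof (rule Int_stableI)
  have *: "ball_Zp k a \<inter> ball_Zp l b \<in> balls_Zp" if "k \<le> l" for k l a b
  proof (cases "b mod int p ^ k = a")
    case True
    then have "ball_Zp k a \<inter> ball_Zp l b = ball_Zp l b"
      using Zp_mod[OF _ that] by (auto simp: ball_Zp_def)
    then show ?thesis by (simp add: ball_Zp_in)
  next
    case False
    then have "ball_Zp k a \<inter> ball_Zp l b = {}"
      using Zp_mod[OF _ that] by (auto simp: ball_Zp_def)
    then show ?thesis by (simp add: balls_Zp_def)
  qed
  fix A B assume A: "A \<in> balls_Zp" and B: "B \<in> balls_Zp"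
  show "A \<inter> B \<in> balls_Zp"
  proof (cases "A = {} \<or> B = {}")
    case True
    then show ?thesis by (auto simp: balls_Zp_def)
  next
    case False
    then obtain k a l b where "A = ball_Zp k a" "B = ball_Zp l b"
      using A B by (auto simp: balls_Zp_def)
    then show ?thesis
      using *[of k l a b] *[of l k b a] by (cases "k \<le> l") (simp_all add: Int_commute)
  qed
qed

lemma openin_ball_Zp:
  "openin (Metric_space.mtopology (carrier (Zp p)) (padic_dist p)) (ball_Zp k a)"
proof -
  interpret Metric_space "carrier (Zp p)" "padic_dist p" by (rule Metric_space_Zp)
  show ?thesis
    unfolding openin_mtopology
  proof (intro conjI allI impI)
    fix x assume "x \<in> ball_Zp k a"
    then have "mball x (1 / real p ^ k) \<subseteq> ball_Zp k a"
      using padic_dist_le_iff[of x _ k] by (force simp: ball_Zp_def)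
    moreover have "1 / real p ^ k > 0" using p by simp
    ultimately show "\<exists>r>0. mball x r \<subseteq> ball_Zp k a" by blast
  qed (auto simp: ball_Zp_def)
qed

lemma open_Zp_Union:
  assumes U: "openin (Metric_space.mtopology (carrier (Zp p)) (padic_dist p)) U"
  shows "U = \<Union>{B \<in> balls_Zp. B \<subseteq> U}"
proof -
  interpret Metric_space "carrier (Zp p)" "padic_dist p" by (rule Metric_space_Zp)
  have "\<exists>B\<in>balls_Zp. B \<subseteq> U \<and> x \<in> B" if "x \<in> U" for x
  proof -
    obtain r where r: "r > 0" "mball x r \<subseteq> U" and x: "x \<in> carrier (Zp p)"
      using U \<open>x \<in> U\<close> unfolding openin_mtopology by blast
    obtain k where k: "(1 / real p) ^ k < r"
      using real_arch_pow_inv[of r "1 / real p"] r p by auto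
    have "ball_Zp k (x k) \<subseteq> mball x r"
      using x k padic_dist_le_iff[of x _ k] by (fastforce simp: ball_Zp_def power_one_over)
    then show ?thesis
      using x r by (intro bexI[OF _ ball_Zp_in[of k "x k"]]) (auto simp: ball_Zp_def)
  qed
  then show ?thesis by blast
qed

lemma sets_Zp_borel: "sets (Zp_borel p) = sigma_sets (carrier (Zp p)) balls_Zp"
proof -
  let ?T = "{U. openin (Metric_space.mtopology (carrier (Zp p)) (padic_dist p)) U}"
  interpret Metric_space "carrier (Zp p)" "padic_dist p" by (rule Metric_space_Zp)
  have T: "?T \<subseteq> Pow (carrier (Zp p))"
    by (auto simp: openin_mtopology)
  have "sigma_sets (carrier (Zp p)) ?T = sigma_sets (carrier (Zp p)) balls_Zp"
  proof (rule sigma_sets_eqI)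
    fix U assume "U \<in> ?T"
    then have "U = \<Union>{B \<in> balls_Zp. B \<subseteq> U}" using open_Zp_Union by blast
    moreover have "\<Union>{B \<in> balls_Zp. B \<subseteq> U} \<in> sigma_sets (carrier (Zp p)) balls_Zp"
      by (rule sigma_sets_UNION)
         (auto intro: countable_subset[OF _ countable_balls_Zp] sigma_sets.Basic)
    ultimately show "U \<in> sigma_sets (carrier (Zp p)) balls_Zp" by simp
  next
    fix B assume "B \<in> balls_Zp"
    then show "B \<in> sigma_sets (carrier (Zp p)) ?T"
      by (auto simp: balls_Zp_def intro: sigma_sets.Empty sigma_sets.Basic openin_ball_Zp)
  qed
  then show ?thesis using T by (simp add: Zp_borel_def)
qed

lemma space_Zp_borel: "space (Zp_borel p) = carrier (Zp p)"
  by (simp add: Zp_borel_def space_measure_of_conv)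

lemma ball_Zp_translate:
  assumes a: "a \<in> carrier (Zp p)"
  shows "(\<lambda>x. a \<oplus>\<^bsub>Zp p\<^esub> x) ` ball_Zp k b
           = (if b \<in> {0..<int p ^ k} then ball_Zp k ((a k + b) mod int p ^ k) else {})"
proof -
  interpret cring "Zp p" by (rule cring_Zp)
  have "\<exists>x \<in> ball_Zp k b. y = a \<oplus>\<^bsub>Zp p\<^esub> x"
    if y: "y \<in> ball_Zp k ((a k + b) mod int p ^ k)" and b: "b \<in> {0..<int p ^ k}" for y
  proof (rule bexI)
    have yc: "y \<in> carrier (Zp p)" using y by (simp add: ball_Zp_def)
    show "y = a \<oplus>\<^bsub>Zp p\<^esub> (y \<ominus>\<^bsub>Zp p\<^esub> a)"
      using a yc by algebra
    show "y \<ominus>\<^bsub>Zp p\<^esub> a \<in> ball_Zp k b"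
      using y b a yc by (simp add: ball_Zp_def) (simp add: Zp_minus mod_diff_left_eq)
  qed
  moreover have "a \<oplus>\<^bsub>Zp p\<^esub> x \<in> ball_Zp k ((a k + b) mod int p ^ k)" if "x \<in> ball_Zp k b" for x
    using that a by (auto simp: ball_Zp_def) (simp add: Zp_simps(3))
  moreover have "ball_Zp k b = {}" if "b \<notin> {0..<int p ^ k}"
    using that Zp_bounds by (force simp: ball_Zp_def)
  ultimately show ?thesis by auto
qed

text \<open>The existence proof builds the measure from independent uniformly distributed digits.\<close>

definition digits_to_Zp :: "(nat \<Rightarrow> int) \<Rightarrow> nat \<Rightarrow> int" where
  "digits_to_Zp w k = (\<Sum>i<k. w i * int p ^ i)"

definition digit_measure :: "(nat \<Rightarrow> int) measure" where
  "digit_measure = PiM UNIV (\<lambda>_. uniform_count_measure {0..<int p})"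

lemma space_digit_measure: "space digit_measure = {w. \<forall>i. w i \<in> {0..<int p}}"
  by (auto simp: digit_measure_def space_PiM space_uniform_count_measure)

lemma digits_bounds:
  assumes "w \<in> space digit_measure"
  shows "0 \<le> digits_to_Zp w k \<and> digits_to_Zp w k < int p ^ k"
proof (induction k)
  case (Suc k)
  have w: "0 \<le> w k" "w k \<le> int p - 1" using assms by (auto simp: space_digit_measure)
  then have "w k * int p ^ k \<le> (int p - 1) * int p ^ k" by (intro mult_right_mono) auto
  then show ?case using Suc w by (simp add: digits_to_Zp_def algebra_simps)
qed (simp add: digits_to_Zp_def)

lemma digits_to_Zp_carrier:
  assumes "w \<in> space digit_measure"
  shows "digits_to_Zp w \<in> carrier (Zp p)"
proof -
  have "digits_to_Zp w (Suc k) mod int p ^ k = digits_to_Zp w k" for k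
    using digits_bounds[OF assms, of k] by (simp add: digits_to_Zp_def)
  then show ?thesis using digits_bounds[OF assms] by (simp add: Zp_simps)
qed

lemma digits_eq_iff:
  assumes w: "w \<in> space digit_measure" and x: "x \<in> carrier (Zp p)"
  shows "digits_to_Zp w k = x k \<longleftrightarrow> (\<forall>i<k. w i = x (Suc i) div int p ^ i)"
proof (induction k)
  case 0
  show ?case using Zp_bounds[OF x, of 0] by (simp add: digits_to_Zp_def)
next
  case (Suc k)
  have D: "digits_to_Zp w (Suc k) = digits_to_Zp w k + w k * int p ^ k"
    by (simp add: digits_to_Zp_def)
  have b: "0 \<le> digits_to_Zp w k" "digits_to_Zp w k < int p ^ k"
    using digits_bounds[OF w] by auto
  have m: "x (Suc k) mod int p ^ k = x k" using x by (simp add: Zp_simps)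
  have pk: "int p ^ k > 0" using p by simp
  have "digits_to_Zp w (Suc k) = x (Suc k) \<longleftrightarrow>
        digits_to_Zp w k = x k \<and> w k = x (Suc k) div int p ^ k"
  proof
    assume e: "digits_to_Zp w (Suc k) = x (Suc k)"
    have "x (Suc k) mod int p ^ k = digits_to_Zp w k" "x (Suc k) div int p ^ k = w k"
      using b pk by (simp_all add: e[symmetric] D)
    then show "digits_to_Zp w k = x k \<and> w k = x (Suc k) div int p ^ k" using m by simp
  next
    assume "digits_to_Zp w k = x k \<and> w k = x (Suc k) div int p ^ k"
    then show "digits_to_Zp w (Suc k) = x (Suc k)"
      using div_mult_mod_eq[of "x (Suc k)" "int p ^ k"] m by (simp add: D)
  qed
  then show ?case using Suc by (auto simp: less_Suc_eq)
qed

lemma digit_cylinder: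
  assumes "b \<in> {0..<int p ^ k}"
  shows "{w \<in> space digit_measure. digits_to_Zp w k = b} \<in> sets digit_measure"
    and "emeasure digit_measure {w \<in> space digit_measure. digits_to_Zp w k = b} = ennreal (1 / real p ^ k)"
proof -
  let ?U = "uniform_count_measure {0..<int p}"
  interpret U: prob_space ?U using p by (intro prob_space_uniform_count_measure) auto
  interpret P: product_prob_space "\<lambda>_. ?U" "UNIV :: nat set"
    by unfold_locales
  define x where "x = (\<lambda>j. b mod int p ^ j)"
  have x: "x \<in> carrier (Zp p)" unfolding x_def by (intro Zp_memI) simp
  have xk: "x k = b" using assms by (simp add: x_def)
  define X where "X i = {x (Suc i) div int p ^ i}" for i
  have X: "X i \<subseteq> {0..<int p}" for i
  proof -
    have "x (Suc i) div int p ^ i < int p"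
    proof -
      have "int p ^ i * (x (Suc i) div int p ^ i) = x (Suc i) - x (Suc i) mod int p ^ i"
        by (simp add: minus_mod_eq_mult_div)
      also have "\<dots> \<le> x (Suc i)" using p by simp
      also have "\<dots> < int p ^ i * int p"
        using Zp_bounds[OF x, of "Suc i"] by (simp add: mult.commute)
      finally show ?thesis using p by simp
    qed
    moreover have "0 \<le> x (Suc i) div int p ^ i"
      using Zp_bounds[OF x, of "Suc i"] p by (simp add: pos_imp_zdiv_nonneg_iff)
    ultimately show ?thesis by (simp add: X_def)
  qed
  have eq: "{w \<in> space digit_measure. digits_to_Zp w k = b}
      = {w \<in> space (PiM UNIV (\<lambda>_. ?U)). \<forall>i\<in>{..<k}. w i \<in> X i}"
    using digits_eq_iff[OF _ x, of _ k] by (auto simp: xk X_def digit_measure_def)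
  show "{w \<in> space digit_measure. digits_to_Zp w k = b} \<in> sets digit_measure"
    unfolding eq unfolding digit_measure_def using X
    by (intro sets.sets_Collect_finite_All sets_Collect_single') 
       (auto simp: sets_uniform_count_measure space_uniform_count_measure)
  have "emeasure digit_measure {w \<in> space digit_measure. digits_to_Zp w k = b}
      = (\<Prod>i\<in>{..<k}. emeasure ?U (X i))"
    unfolding eq unfolding digit_measure_def using X
    by (intro P.emeasure_PiM_Collect) (auto simp: sets_uniform_count_measure)
  also have "\<dots> = (\<Prod>i\<in>{..<k}. ennreal (1 / real p))"
    using X by (intro prod.cong) (auto simp: emeasure_uniform_count_measure, simp add: X_def)
  also have "\<dots> = ennreal (1 / real p ^ k)"
    by (simp add: ennreal_power power_one_over)
  finally show "emeasure digit_measure {w \<in> space digit_measure. digits_to_Zp w k = b} = ennreal (1 / real p ^ k)" .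
qed

definition haar_Zp_model :: "(nat \<Rightarrow> int) measure" where
  "haar_Zp_model = distr digit_measure (Zp_borel p) digits_to_Zp"

lemma measurable_digits_to_Zp: "digits_to_Zp \<in> measurable digit_measure (Zp_borel p)"
proof (rule measurable_sigma_sets[OF sets_Zp_borel balls_Zp_subset])
  show "digits_to_Zp \<in> space digit_measure \<rightarrow> carrier (Zp p)"
    using digits_to_Zp_carrier by auto
  fix B assume "B \<in> balls_Zp"
  then consider "B = {}" | k b where "B = ball_Zp k b" by (auto simp: balls_Zp_def)
  then show "digits_to_Zp -` B \<inter> space digit_measure \<in> sets digit_measure"
  proof cases
    case 2
    have "digits_to_Zp -` B \<inter> space digit_measure = {w \<in> space digit_measure. digits_to_Zp w k = b}"
      using digits_to_Zp_carrier by (auto simp: 2 ball_Zp_def)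
    moreover have "{w \<in> space digit_measure. digits_to_Zp w k = b} \<in> sets digit_measure"
    proof (cases "b \<in> {0..<int p ^ k}")
      case False
      then have "digits_to_Zp w k \<noteq> b" if "w \<in> space digit_measure" for w
        using digits_bounds[OF that, of k] by auto
      then have "{w \<in> space digit_measure. digits_to_Zp w k = b} = {}" by blast
      then show ?thesis by (simp only: sets.empty_sets)
    qed (rule digit_cylinder)
    ultimately show ?thesis by simp
  qed simp
qed

lemma emeasure_haar_Zp_model_ball:
  assumes "b \<in> {0..<int p ^ k}"
  shows "emeasure haar_Zp_model (ball_Zp k b) = ennreal (1 / real p ^ k)"
proof -
  have "digits_to_Zp -` ball_Zp k b \<inter> space digit_measure = {w \<in> space digit_measure. digits_to_Zp w k = b}"
    using digits_to_Zp_carrier by (auto simp: ball_Zp_def)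
  then show ?thesis
    unfolding haar_Zp_model_def
    using digit_cylinder(2)[OF assms]
    by (subst emeasure_distr[OF measurable_digits_to_Zp])
       (simp_all add: sets_Zp_borel sigma_sets.Basic ball_Zp_in)
qed

lemma carrier_Zp_eq_ball: "carrier (Zp p) = ball_Zp 0 0"
  using Zp_bounds[of _ 0] by (force simp: ball_Zp_def)

lemma Zp_measure_eqI:
  assumes "sets M = sets (Zp_borel p)" "sets N = sets (Zp_borel p)"
    and eq: "\<And>k b. b \<in> {0..<int p ^ k} \<Longrightarrow> emeasure M (ball_Zp k b) = emeasure N (ball_Zp k b)"
    and "emeasure M (carrier (Zp p)) \<noteq> \<infinity>"
  shows "M = N"
proof (rule measure_eqI_generator_eq[OF Int_stable_balls_Zp balls_Zp_subset,
        where A = "\<lambda>_. carrier (Zp p)"])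
  fix B assume "B \<in> balls_Zp"
  then consider "B = {}" | k b where "B = ball_Zp k b" by (auto simp: balls_Zp_def)
  then show "emeasure M B = emeasure N B"
  proof cases
    case 2
    have "ball_Zp k b = {}" if "b \<notin> {0..<int p ^ k}" using that Zp_bounds by (force simp: ball_Zp_def)
    then show ?thesis using eq 2 by (cases "b \<in> {0..<int p ^ k}") auto
  qed simp
qed (use assms in \<open>auto simp: sets_Zp_borel carrier_Zp_eq_ball ball_Zp_in\<close>)

lemma ball_Zp_sets: "ball_Zp k b \<in> sets (Zp_borel p)"
  by (auto simp: sets_Zp_borel intro: sigma_sets.Basic ball_Zp_in)

lemma measurable_translate_Zp:
  assumes a: "a \<in> carrier (Zp p)"
  shows "(\<lambda>x. x \<ominus>\<^bsub>Zp p\<^esub> a) \<in> measurable (Zp_borel p) (Zp_borel p)"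
    and "A \<subseteq> carrier (Zp p) \<Longrightarrow>
      (\<lambda>x. x \<ominus>\<^bsub>Zp p\<^esub> a) -` A \<inter> carrier (Zp p) = (\<lambda>x. a \<oplus>\<^bsub>Zp p\<^esub> x) ` A"
proof -
  interpret cring "Zp p" by (rule cring_Zp)
  have 2: "(\<lambda>x. x \<ominus>\<^bsub>Zp p\<^esub> a) -` A \<inter> carrier (Zp p) = (\<lambda>x. a \<oplus>\<^bsub>Zp p\<^esub> x) ` A"
    if "A \<subseteq> carrier (Zp p)" for A
  proof (intro equalityI subsetI)
    fix x assume x: "x \<in> (\<lambda>x. x \<ominus>\<^bsub>Zp p\<^esub> a) -` A \<inter> carrier (Zp p)"
    then have "x = a \<oplus>\<^bsub>Zp p\<^esub> (x \<ominus>\<^bsub>Zp p\<^esub> a)" using a by (auto; algebra)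
    then show "x \<in> (\<lambda>x. a \<oplus>\<^bsub>Zp p\<^esub> x) ` A" using x by blast
  next
    fix x assume "x \<in> (\<lambda>x. a \<oplus>\<^bsub>Zp p\<^esub> x) ` A"
    then obtain y where y: "y \<in> A" "x = a \<oplus>\<^bsub>Zp p\<^esub> y" by blast
    then have yc: "y \<in> carrier (Zp p)" using that by blast
    then have "x \<ominus>\<^bsub>Zp p\<^esub> a = y" unfolding y(2) using a by algebra
    then show "x \<in> (\<lambda>x. x \<ominus>\<^bsub>Zp p\<^esub> a) -` A \<inter> carrier (Zp p)" using y a yc by auto
  qed
  show "A \<subseteq> carrier (Zp p) \<Longrightarrow>
      (\<lambda>x. x \<ominus>\<^bsub>Zp p\<^esub> a) -` A \<inter> carrier (Zp p) = (\<lambda>x. a \<oplus>\<^bsub>Zp p\<^esub> x) ` A" by (rule 2)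
  show "(\<lambda>x. x \<ominus>\<^bsub>Zp p\<^esub> a) \<in> measurable (Zp_borel p) (Zp_borel p)"
  proof (rule measurable_sigma_sets[OF sets_Zp_borel balls_Zp_subset])
    show "(\<lambda>x. x \<ominus>\<^bsub>Zp p\<^esub> a) \<in> space (Zp_borel p) \<rightarrow> carrier (Zp p)"
      using a by (auto simp: space_Zp_borel)
    fix B assume B: "B \<in> balls_Zp"
    then have "(\<lambda>x. x \<ominus>\<^bsub>Zp p\<^esub> a) -` B \<inter> space (Zp_borel p) = (\<lambda>x. a \<oplus>\<^bsub>Zp p\<^esub> x) ` B"
      using balls_Zp_subset by (subst space_Zp_borel, intro 2) auto
    also have "\<dots> \<in> sets (Zp_borel p)"
      using B by (auto simp: balls_Zp_def ball_Zp_translate[OF a] ball_Zp_sets)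
    finally show "(\<lambda>x. x \<ominus>\<^bsub>Zp p\<^esub> a) -` B \<inter> space (Zp_borel p) \<in> sets (Zp_borel p)" .
  qed
qed

lemma normalized_haar_model: "normalized_haar p haar_Zp_model"
proof -
  let ?M = haar_Zp_model
  have sets: "sets ?M = sets (Zp_borel p)" by (simp add: haar_Zp_model_def)
  have one: "emeasure ?M (carrier (Zp p)) = 1"
    using emeasure_haar_Zp_model_ball[of 0 0] by (simp add: carrier_Zp_eq_ball)
  have "emeasure ?M ((\<lambda>x. a \<oplus>\<^bsub>Zp p\<^esub> x) ` A) = emeasure ?M A"
    if a: "a \<in> carrier (Zp p)" and A: "A \<in> sets ?M" for a A
  proof -
    have meas: "(\<lambda>x. x \<ominus>\<^bsub>Zp p\<^esub> a) \<in> measurable ?M (Zp_borel p)"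
      using measurable_translate_Zp(1)[OF a] sets by (simp add: measurable_def space_Zp_borel sets_eq_imp_space_eq[OF sets])
    have sub: "B \<subseteq> carrier (Zp p)" if "B \<in> sets (Zp_borel p)" for B
      using sets.sets_into_space[OF that] by (simp add: space_Zp_borel)
    have em: "emeasure (distr ?M (Zp_borel p) (\<lambda>x. x \<ominus>\<^bsub>Zp p\<^esub> a)) B = emeasure ?M ((\<lambda>x. a \<oplus>\<^bsub>Zp p\<^esub> x) ` B)"
      if "B \<in> sets (Zp_borel p)" for B
      using measurable_translate_Zp(2)[OF a sub[OF that]]
      by (simp add: emeasure_distr[OF meas that] sets_eq_imp_space_eq[OF sets] space_Zp_borel)
    have "?M = distr ?M (Zp_borel p) (\<lambda>x. x \<ominus>\<^bsub>Zp p\<^esub> a)"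
    proof (rule Zp_measure_eqI)
      fix k b assume b: "b \<in> {0..<int p ^ k}"
      have "(a k + b) mod int p ^ k \<in> {0..<int p ^ k}" using p by simp
      then show "emeasure ?M (ball_Zp k b)
          = emeasure (distr ?M (Zp_borel p) (\<lambda>x. x \<ominus>\<^bsub>Zp p\<^esub> a)) (ball_Zp k b)"
        using b by (simp only: em[OF ball_Zp_sets] ball_Zp_translate[OF a] emeasure_haar_Zp_model_ball if_True)
    qed (simp_all add: sets one)
    then show ?thesis using em A sets by metis
  qed
  then show ?thesis using sets one by (auto simp: normalized_haar_def)
qed

lemma emeasure_normalized_haar_ball:
  assumes M: "normalized_haar p M" and b: "b \<in> {0..<int p ^ k}"
  shows "emeasure M (ball_Zp k b) = ennreal (1 / real p ^ k)"
proof -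
  have sets: "ball_Zp k c \<in> sets M" for c using M ball_Zp_sets by (simp add: normalized_haar_def)
  have eq: "emeasure M (ball_Zp k c) = emeasure M (ball_Zp k 0)" if c: "c \<in> {0..<int p ^ k}" for c
  proof -
    define a where "a = (\<lambda>j. c mod int p ^ j)"
    have a: "a \<in> carrier (Zp p)" unfolding a_def by (intro Zp_memI) simp
    have "(\<lambda>x. a \<oplus>\<^bsub>Zp p\<^esub> x) ` ball_Zp k 0 = ball_Zp k c"
      using c p by (simp add: ball_Zp_translate[OF a]) (simp add: a_def)
    then show ?thesis using M a sets[of 0] unfolding normalized_haar_def by metis
  qed
  have "1 = emeasure M (\<Union>c\<in>{0..<int p ^ k}. ball_Zp k c)"
  proof -
    have "(\<Union>c\<in>{0..<int p ^ k}. ball_Zp k c) = carrier (Zp p)"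
      using Zp_bounds by (force simp: ball_Zp_def)
    then show ?thesis using M by (simp add: normalized_haar_def)
  qed
  also have "\<dots> = (\<Sum>c\<in>{0..<int p ^ k}. emeasure M (ball_Zp k c))"
    using sets by (intro sum_emeasure[symmetric]) (auto simp: disjoint_family_on_def ball_Zp_def)
  also have "\<dots> = (\<Sum>c\<in>{0..<int p ^ k}. emeasure M (ball_Zp k 0))"
    by (intro sum.cong refl eq)
  also have "\<dots> = ennreal (real p ^ k) * emeasure M (ball_Zp k 0)"
    by (simp add: nat_power_eq ennreal_of_nat_eq_real_of_nat)
  finally have 1: "ennreal (real p ^ k) * emeasure M (ball_Zp k b) = 1" using eq[OF b] by simp
  have "emeasure M (ball_Zp k b) = ennreal (1 / real p ^ k) * (ennreal (real p ^ k) * emeasure M (ball_Zp k b))"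
    using p by (simp add: mult.assoc[symmetric] ennreal_mult[symmetric])
  then show ?thesis using 1 by simp
qed

lemma ex1_normalized_haar: "\<exists>!M. normalized_haar p M"
proof (rule ex1I[of _ haar_Zp_model], rule normalized_haar_model)
  fix M assume M: "normalized_haar p M"
  show "M = haar_Zp_model"
    using M normalized_haar_model emeasure_normalized_haar_ball[OF M]
      emeasure_normalized_haar_ball[OF normalized_haar_model]
    by (intro Zp_measure_eqI) (auto simp: normalized_haar_def)
qed

lemma normalized_haar_Zp_haar: "normalized_haar p (Zp_haar p)"
  unfolding Zp_haar_def by (rule theI'[OF ex1_normalized_haar])

end

end

theory Submission
  imports Defs
begin

text \<open>
  Let \<open>d = gcd m n\<close>. Scaling by \<open>(x, y) \<mapsto> (p\<^bsup>m/d\<^esup> x, p\<^bsup>n/d\<^esup> y)\<close> multiplies \<open>x\<^sup>n + y\<^sup>m\<close> by \<open>p\<^bsup>mn/d\<^esup>\<close>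
  and the measure by \<open>p\<^bsup>-(m+n)/d\<^esup>\<close>, so the integral over the image of this map is
  \<open>p\<^bsup>-(m+n)/d\<^esup> t\<^bsup>mn/d\<^esup>\<close> times the whole integral. The complement of the image splits into finitely
  many pieces. Where \<open>n ord x\<close> and \<open>m ord y\<close> differ, one summand dominates, and fixing the order
  of its variable makes the integrand constant. The only other points of the complement are pairs
  of units: on a residue class off the curve modulo \<open>p\<close> the integrand is 1, and on a class lying on
  the curve Hensel's lemma gives the measures of the level sets, hence a geometric series.
\<close>

section \<open>Counting solutions modulo prime powers\<close>

lemma card_residue_class:
  fixes p k :: nat and u :: int
  assumes "p > 0" "u \<in> {0..<int p}"
  shows "card {r \<in> {0..<int p ^ Suc k}. r mod int p = u} = p ^ k"
proof -
  have "bij_betw (\<lambda>j. u + int p * j) {0..<int p ^ k} {r \<in> {0..<int p ^ Suc k}. r mod int p = u}"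
  proof (rule bij_betwI[where g = "\<lambda>r. r div int p"])
    show "(\<lambda>j. u + int p * j) \<in> {0..<int p ^ k} \<rightarrow> {r \<in> {0..<int p ^ Suc k}. r mod int p = u}"
    proof
      fix j assume "j \<in> {0..<int p ^ k}"
      then have "0 \<le> j" "int p * (j + 1) \<le> int p * int p ^ k"
        by (auto intro!: mult_left_mono)
      then show "u + int p * j \<in> {r \<in> {0..<int p ^ Suc k}. r mod int p = u}"
        using assms by (auto simp: algebra_simps)
    qed
    show "(\<lambda>r. r div int p) \<in> {r \<in> {0..<int p ^ Suc k}. r mod int p = u} \<rightarrow> {0..<int p ^ k}"
    proof
      fix r assume r: "r \<in> {r \<in> {0..<int p ^ Suc k}. r mod int p = u}"
      then have "r < int p ^ Suc k" "0 \<le> r mod int p" using assms by auto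
      then have "int p * (r div int p) < int p ^ Suc k"
        using mult_div_mod_eq[of "int p" r] by linarith
      then have "r div int p < int p ^ k" using assms by simp
      then show "r div int p \<in> {0..<int p ^ k}"
        using r assms by (simp add: pos_imp_zdiv_nonneg_iff)
    qed
  qed (use assms in \<open>auto simp: mod_mult_div_eq\<close>)
  then show ?thesis
    by (simp add: bij_betw_same_card[symmetric] nat_power_eq)
qed

lemma prime_power_dvd_mult_right:
  fixes p :: nat and a b :: int
  assumes "prime p" "\<not> int p dvd a" "int p ^ k dvd b * a"
  shows "int p ^ k dvd b"
proof -
  have "coprime (int p ^ k) a"
    using assms by (simp add: prime_imp_coprime)
  then show ?thesis using assms(3) by (simp add: coprime_dvd_mult_left_iff)
qed

text \<open>The cofactor \<open>S\<close> in \<open>r ^ n - r' ^ n = (r - r') * S\<close> is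
  congruent to n r^(n-1) modulo p. Since p divides neither n nor r, it is a unit modulo p, so all of
  p^k must divide \<open>r - r'\<close>. This is the nonvanishing derivative of Hensel's
  lemma.\<close>

lemma power_diff_prime_power_dvd:
  fixes p n k :: nat and r r' :: int
  assumes p: "prime p" and n: "\<not> p dvd n" and r: "\<not> int p dvd r" and cong: "r mod int p = r' mod int p"
    and dv: "int p ^ k dvd r ^ n - r' ^ n"
  shows "int p ^ k dvd r - r'"
proof -
  define S where "S = (\<Sum>i<n. r' ^ (n - Suc i) * r ^ i)"
  have "[S = (\<Sum>i<n. r ^ (n - Suc i) * r ^ i)] (mod int p)"
    unfolding S_def using cong
    by (intro cong_sum cong_mult cong_pow) (auto simp: cong_def)
  also have "(\<Sum>i<n. r ^ (n - Suc i) * r ^ i) = int n * r ^ (n - 1)"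
    by (simp add: power_add[symmetric])
  finally have "[S = int n * r ^ (n - 1)] (mod int p)" .
  moreover have "\<not> int p dvd int n * r ^ (n - 1)"
    using p n r by (simp add: prime_dvd_mult_iff prime_dvd_power_iff) (metis prime_dvd_power prime_nat_int_transfer)
  ultimately have "\<not> int p dvd S" by (simp add: cong_dvd_iff)
  moreover have "r ^ n - r' ^ n = (r - r') * S"
    unfolding S_def by (rule power_diff_sumr2)
  ultimately show ?thesis
    using prime_power_dvd_mult_right[OF p] dv by metis
qed

text \<open>Hensel's lemma by counting: modulo \<open>p\<^sup>k\<close> the map \<open>r \<mapsto> r\<^sup>n + c\<close> is injective from the residue
  class of \<open>u\<close> to the residue class of 0, and these have the same size.\<close>

lemma ex1_root_mod_prime_power:
  fixes p n k :: nat and u c :: int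
  assumes p: "prime p" and n: "\<not> p dvd n" and u: "u \<in> {1..<int p}" and c: "int p dvd u ^ n + c"
  shows "\<exists>!r. r \<in> {0..<int p ^ Suc k} \<and> r mod int p = u \<and> int p ^ Suc k dvd r ^ n + c"
proof -
  define X where "X w = {r \<in> {0..<int p ^ Suc k}. r mod int p = w}" for w
  define f where "f r = (r ^ n + c) mod int p ^ Suc k" for r
  have p0: "int p > 0" using p by (simp add: prime_gt_0_nat)
  have X: "r \<in> {0..<int p ^ Suc k}" "r mod int p = u" "\<not> int p dvd r" if "r \<in> X u" for r
    using that u by (auto simp: X_def)
  have inj: "inj_on f (X u)"
  proof (rule inj_onI)
    fix r r' assume r: "r \<in> X u" and r': "r' \<in> X u" and eq: "f r = f r'"
    have "int p ^ Suc k dvd r ^ n - r' ^ n"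
      using eq by (simp add: f_def mod_eq_dvd_iff)
    then have "int p ^ Suc k dvd r - r'"
      using X(2)[OF r] X(2)[OF r'] by (intro power_diff_prime_power_dvd[OF p n X(3)[OF r]]) simp_all
    then have "r mod int p ^ Suc k = r' mod int p ^ Suc k" by (simp add: mod_eq_dvd_iff)
    then show "r = r'" using X(1)[OF r] X(1)[OF r'] by simp
  qed
  have "f r \<in> X 0" if "r \<in> X u" for r
  proof -
    have "f r mod int p = (r ^ n + c) mod int p"
      unfolding f_def by (rule mod_mod_cancel) simp
    also have "\<dots> = ((r mod int p) ^ n + c) mod int p"
      by (metis mod_add_left_eq power_mod)
    also have "\<dots> = 0" using c X(2)[OF that] by simp
    finally show ?thesis using p0 by (simp add: X_def f_def)
  qed
  then have "f ` X u \<subseteq> X 0" by auto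
  moreover have fin: "finite (X w)" for w
    by (auto simp: X_def intro: finite_subset[of _ "{0..<int p ^ Suc k}"])
  moreover have "card (X u) = card (X 0)"
    unfolding X_def using u p0 by (subst (1 2) card_residue_class) auto
  ultimately have "f ` X u = X 0"
    using inj by (intro card_subset_eq) (simp_all add: card_image)
  moreover have "0 \<in> X 0" using p0 by (simp add: X_def)
  ultimately obtain r where r: "r \<in> X u" "f r = 0" by force
  show ?thesis
  proof (rule ex1I[of _ r])
    show "r \<in> {0..<int p ^ Suc k} \<and> r mod int p = u \<and> int p ^ Suc k dvd r ^ n + c"
      using r by (auto simp: X_def f_def mod_eq_0_iff_dvd)
    fix r' assume "r' \<in> {0..<int p ^ Suc k} \<and> r' mod int p = u \<and> int p ^ Suc k dvd r' ^ n + c"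
    then have "r' \<in> X u" "f r' = 0" by (auto simp: X_def f_def)
    then show "r' = r" using inj_onD[OF inj] r by metis
  qed
qed

lemma card_Sigma_ex1:
  assumes "finite B" "\<And>b. b \<in> B \<Longrightarrow> \<exists>!a. P a b"
  shows "card {(a, b). b \<in> B \<and> P a b} = card B"
proof -
  have "bij_betw snd {(a, b). b \<in> B \<and> P a b} B"
    using assms(2) by (intro bij_betw_imageI) (force simp: inj_on_def image_def)+
  then show ?thesis by (rule bij_betw_same_card)
qed

text \<open>If p does not divide n, every lift q of v determines its r uniquely by Hensel's lemma,
  so there are as many pairs as lifts of v.\<close>

lemma card_smooth_solutions:
  fixes p m n k :: nat and u v :: int
  assumes p: "prime p" and mn: "\<not> (p dvd m \<and> p dvd n)"
    and u: "u \<in> {1..<int p}" and v: "v \<in> {1..<int p}" and uv: "int p dvd u ^ n + v ^ m"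
  shows "card {(r, q) \<in> {0..<int p ^ Suc k} \<times> {0..<int p ^ Suc k}.
      r mod int p = u \<and> q mod int p = v \<and> int p ^ Suc k dvd r ^ n + q ^ m} = p ^ k"
proof -
  have *: "card {(r, q) \<in> {0..<int p ^ Suc k} \<times> {0..<int p ^ Suc k}.
      r mod int p = u \<and> q mod int p = v \<and> int p ^ Suc k dvd r ^ n + q ^ m} = p ^ k"
    if n: "\<not> p dvd n" and u: "u \<in> {1..<int p}" and v: "v \<in> {1..<int p}" and uv: "int p dvd u ^ n + v ^ m"
    for m n u v
  proof -
    define B where "B = {q \<in> {0..<int p ^ Suc k}. q mod int p = v}"
    have "{(r, q) \<in> {0..<int p ^ Suc k} \<times> {0..<int p ^ Suc k}.
        r mod int p = u \<and> q mod int p = v \<and> int p ^ Suc k dvd r ^ n + q ^ m}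
      = {(r, q). q \<in> B \<and> r \<in> {0..<int p ^ Suc k} \<and> r mod int p = u \<and> int p ^ Suc k dvd r ^ n + q ^ m}"
      by (auto simp: B_def)
    also have "card \<dots> = card B"
    proof (rule card_Sigma_ex1)
      fix q assume "q \<in> B"
      then have "[q ^ m = v ^ m] (mod int p)"
        using v by (intro cong_pow) (simp add: B_def cong_def)
      then have "[u ^ n + q ^ m = u ^ n + v ^ m] (mod int p)"
        by (intro cong_add) auto
      then have "int p dvd u ^ n + q ^ m" using uv by (simp add: cong_dvd_iff)
      then show "\<exists>!r. r \<in> {0..<int p ^ Suc k} \<and> r mod int p = u \<and> int p ^ Suc k dvd r ^ n + q ^ m"
        by (rule ex1_root_mod_prime_power[OF p n u])
    qed (auto simp: B_def intro: finite_subset[of _ "{0..<int p ^ Suc k}"])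
    also have "\<dots> = p ^ k"
      unfolding B_def using v p by (intro card_residue_class) (auto simp: prime_gt_0_nat)
    finally show ?thesis .
  qed
  show ?thesis
  proof (cases "p dvd n")
    case False
    then show ?thesis using * u v uv by blast
  next
    case True
    let ?T = "{(r, q) \<in> {0..<int p ^ Suc k} \<times> {0..<int p ^ Suc k}.
      r mod int p = u \<and> q mod int p = v \<and> int p ^ Suc k dvd r ^ n + q ^ m}"
    \<comment> \<open>Now p does not divide m, so the equation is solved for the second coordinate;
      transposing the pairs preserves their number.\<close>
    have "card {(r, q) \<in> {0..<int p ^ Suc k} \<times> {0..<int p ^ Suc k}.
      r mod int p = v \<and> q mod int p = u \<and> int p ^ Suc k dvd r ^ m + q ^ n} = p ^ k"
      using True mn u v uv by (intro *) (auto simp: add.commute)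
    also have "{(r, q) \<in> {0..<int p ^ Suc k} \<times> {0..<int p ^ Suc k}.
      r mod int p = v \<and> q mod int p = u \<and> int p ^ Suc k dvd r ^ m + q ^ n} = ?T\<inverse>"
      by (auto simp: add.commute)
    finally show ?thesis by simp
  qed
qed

text \<open>If one coordinate of a root vanishes modulo p, then p divides a power of the other and
  hence the other itself. The origin is thus the only root outside the unit classes, and
  \<open>N - 1\<close> in the formula counts the root classes of units.\<close>

lemma card_unit_solutions:
  fixes p m n :: nat
  defines "R \<equiv> residue_ring (int p)"
  assumes p: "prime p" and mn: "m > 0" "n > 0"
  shows "card {(x, y). x \<in> carrier R \<and> y \<in> carrier R \<and> x [^]\<^bsub>R\<^esub> n \<oplus>\<^bsub>R\<^esub> y [^]\<^bsub>R\<^esub> m = \<zero>\<^bsub>R\<^esub>}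
    = Suc (card {(u, v) \<in> {1..<int p} \<times> {1..<int p}. int p dvd u ^ n + v ^ m})"
    (is "card ?A = Suc (card ?B)")
proof -
  have p1: "int p > 1" using prime_gt_1_nat[OF p] by simp
  interpret residues "int p" R
    using p1 by unfold_locales (simp_all add: R_def)
  have pi: "prime (int p)" using p by simp
  have sol: "x [^]\<^bsub>R\<^esub> n \<oplus>\<^bsub>R\<^esub> y [^]\<^bsub>R\<^esub> m = \<zero>\<^bsub>R\<^esub> \<longleftrightarrow> int p dvd x ^ n + y ^ m"
    if "x \<in> carrier R" "y \<in> carrier R" for x y
  proof -
    have "x mod int p = x" "y mod int p = y" using that by (simp_all add: res_carrier_eq)
    then have "x [^]\<^bsub>R\<^esub> n = x ^ n mod int p" "y [^]\<^bsub>R\<^esub> m = y ^ m mod int p"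
      using pow_cong[of x n] pow_cong[of y m] by simp_all
    then show ?thesis by (simp add: res_add_eq res_zero_eq mod_add_eq mod_eq_0_iff_dvd)
  qed
  have 1: "y = 0" if "x = 0" "int p dvd x ^ n + y ^ m" "y \<in> {0..<int p}" for x y
    using that mn pi by (auto simp: zero_power prime_dvd_power_iff zdvd_not_zless dest: zdvd_imp_le)
  have 2: "x = 0" if "y = 0" "int p dvd x ^ n + y ^ m" "x \<in> {0..<int p}" for x y
    using that mn pi by (auto simp: zero_power prime_dvd_power_iff zdvd_not_zless dest: zdvd_imp_le)
  have "?A = insert (0, 0) ?B"
  proof (intro equalityI subsetI)
    fix w assume w: "w \<in> ?A"
    obtain x y where xy: "w = (x, y)" by (cases w)
    then have c: "x \<in> carrier R" "y \<in> carrier R" "int p dvd x ^ n + y ^ m" using w sol by auto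
    then show "w \<in> insert (0, 0) ?B"
      using 1[of x y] 2[of y x] by (cases "x = 0"; cases "y = 0") (auto simp: xy res_carrier_eq)
  next
    fix w assume "w \<in> insert (0, 0) ?B"
    then show "w \<in> ?A" using sol mn p1 by (auto simp: res_carrier_eq zero_power)
  qed
  moreover have "finite ?B" by (rule finite_subset[of _ "{1..<int p} \<times> {1..<int p}"]) auto
  ultimately show ?thesis by simp
qed

section \<open>Powers of the p-adic absolute value\<close>

text \<open>Since \<open>0 powr s\<close> is 0, the convention a^s = 0 for a = 0 is built
  in.\<close>

definition abs_powr :: "nat \<Rightarrow> complex \<Rightarrow> (nat \<Rightarrow> int) \<Rightarrow> complex" where
  "abs_powr p s z = complex_of_real (padic_abs p z) powr s"

context
  fixes p :: nat
  assumes p: "p > 1"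
begin

lemma Zp_pow_closed: "x \<in> carrier (Zp p) \<Longrightarrow> x [^]\<^bsub>Zp p\<^esub> (n::nat) \<in> carrier (Zp p)"
proof -
  interpret cring "Zp p" by (rule cring_Zp[OF p])
  show "x \<in> carrier (Zp p) \<Longrightarrow> x [^]\<^bsub>Zp p\<^esub> n \<in> carrier (Zp p)" by simp
qed

lemma Zp_pow_nth: "(x [^]\<^bsub>Zp p\<^esub> (n::nat)) k = x k ^ n mod int p ^ k"
proof -
  interpret cring "Zp p" by (rule cring_Zp[OF p])
  show ?thesis
  proof (induction n)
    case 0
    show ?case by (simp add: Zp_simps(4)[OF p])
  next
    case (Suc n)
    then show ?case by (simp add: Zp_simps(2)[OF p] mod_mult_right_eq mult.commute)
  qed
qed

lemma Zp_pow_add_nth: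
  "(x [^]\<^bsub>Zp p\<^esub> (n::nat) \<oplus>\<^bsub>Zp p\<^esub> y [^]\<^bsub>Zp p\<^esub> (m::nat)) k = (x k ^ n + y k ^ m) mod int p ^ k"
  by (simp add: Zp_simps(3)[OF p] Zp_pow_nth mod_add_eq)

lemma Zp_nth_0: "x \<in> carrier (Zp p) \<Longrightarrow> x 0 = 0"
  using Zp_bounds[OF p, of x 0] by simp

lemma Zp_nth_zero_mono: "x \<in> carrier (Zp p) \<Longrightarrow> j \<le> k \<Longrightarrow> x k = 0 \<Longrightarrow> x j = 0"
  using Zp_mod[OF p, of x j k] by simp

lemma Zp_dvd_nth_iff: "x \<in> carrier (Zp p) \<Longrightarrow> j \<le> k \<Longrightarrow> int p ^ j dvd x k \<longleftrightarrow> x j = 0"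
  using Zp_mod[OF p, of x j k] by (auto simp: dvd_eq_mod_eq_0)

text \<open>Here and below, \<open>x a = 0 \<and> x (Suc a) \<noteq> 0\<close> expresses that x has
  p-adic order exactly a. The first nonzero residue comes right after such a level, and residue 0
  always vanishes.\<close>

lemma ex_level_below:
  assumes "x \<in> carrier (Zp p)" "x k \<noteq> 0"
  shows "\<exists>a<k. x a = 0 \<and> x (Suc a) \<noteq> 0"
  using assms(2)
proof (induction k)
  case 0
  then show ?case using Zp_nth_0[OF assms(1)] by simp
next
  case (Suc k)
  then show ?case using less_Suc_eq by (cases "x k = 0") auto
qed

lemma level_unique:
  assumes x: "x \<in> carrier (Zp p)" "x a = 0" "x (Suc a) \<noteq> 0" "x b = 0" "x (Suc b) \<noteq> 0"
  shows "a = b"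
  using Zp_nth_zero_mono[OF x(1), of "Suc a" b] Zp_nth_zero_mono[OF x(1), of "Suc b" a] x
  by (cases a b rule: linorder_cases) simp_all

lemma norm_powr_neg_less_1: "Re s > 0 \<Longrightarrow> norm (of_nat p powr (- s) :: complex) < 1"
proof -
  assume s: "Re s > 0"
  have "norm (of_nat p powr (- s) :: complex) = real p powr (- Re s)"
    using norm_powr_real_powr[of "of_nat p" "- s"] p by simp
  also have "\<dots> < real p powr 0" using p s by (intro powr_less_mono) auto
  finally show ?thesis using p by simp
qed

lemma abs_powr_zero [simp]: "abs_powr p s \<zero>\<^bsub>Zp p\<^esub> = 0"
  by (simp add: abs_powr_def padic_abs_def)

lemma abs_powr_level:
  assumes z: "z \<in> carrier (Zp p)" "z k = 0" "z (Suc k) \<noteq> 0"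
  shows "abs_powr p s z = (of_nat p powr (- s)) ^ k"
proof -
  have nz: "z \<noteq> \<zero>\<^bsub>Zp p\<^esub>" using z by (auto simp: Zp_simps[OF p])
  then have "padic_ord z = k"
    using padic_ord[OF p z(1) nz, of k] padic_ord[OF p z(1) nz, of "Suc k"] z by simp
  \<comment> \<open>Written as the exponential of a real number, the absolute value has this
    exponent as its principal logarithm, so \<open>powr\<close> involves no choice of
    branch.\<close>
  then have "padic_abs p z = exp (- real k * ln (real p))"
    using nz p by (simp add: padic_abs_def exp_minus exp_of_nat_mult divide_inverse)
  then have "abs_powr p s z = exp (s * (- of_nat k * of_real (ln (real p))))"
    unfolding abs_powr_def powr_def by (simp add: Ln_of_real)
  also have "\<dots> = exp (of_nat k * (- s * of_real (ln (real p))))"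
    by (simp add: algebra_simps)
  also have "\<dots> = (of_nat p powr (- s)) ^ k"
    using p Ln_of_real[of "real p"] by (simp only: exp_of_nat_mult powr_def) simp
  finally show ?thesis .
qed

text \<open>At most one term is nonzero, the one at the order of z, and none is for z = 0. This form
  writes the integrand as a series of constants on level sets.\<close>

lemma abs_powr_sums:
  assumes z: "z \<in> carrier (Zp p)"
  shows "(\<lambda>k. of_bool (z k = 0 \<and> z (Suc k) \<noteq> 0) * (of_nat p powr (- s)) ^ k) sums abs_powr p s z"
proof (cases "z = \<zero>\<^bsub>Zp p\<^esub>")
  case True
  then show ?thesis by (simp add: abs_powr_def padic_abs_def) (simp add: Zp_simps(5)[OF p])
next
  case False
  then obtain k' where "z k' \<noteq> 0" by (auto simp: Zp_simps(5)[OF p])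
  then obtain k where k: "z k = 0" "z (Suc k) \<noteq> 0" using ex_level_below[OF z] by blast
  then have "z j = 0 \<and> z (Suc j) \<noteq> 0 \<longleftrightarrow> j = k" for j using level_unique[OF z] by blast
  then have "(\<lambda>k. of_bool (z k = 0 \<and> z (Suc k) \<noteq> 0) * (of_nat p powr (- s)) ^ k)
      = (\<lambda>j. if j = k then (of_nat p powr (- s)) ^ j else 0)" by (simp add: fun_eq_iff)
  then show ?thesis using sums_single[of k "\<lambda>j. (of_nat p powr (- s)) ^ j"] abs_powr_level[OF z k] by simp
qed

section \<open>Integration over the p-adic plane\<close>

lemma sets_Zp_haar [measurable_cong]: "sets (Zp_haar p) = sets (Zp_borel p)"
  using normalized_haar_Zp_haar[OF p] by (simp add: normalized_haar_def)

lemma space_Zp_haar: "space (Zp_haar p) = carrier (Zp p)"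
  using sets_eq_imp_space_eq[OF sets_Zp_haar] by (simp add: space_Zp_borel[OF p])

lemma prob_space_Zp_haar: "prob_space (Zp_haar p)"
  using normalized_haar_Zp_haar[OF p]
  by (intro prob_spaceI) (simp add: normalized_haar_def space_Zp_haar)

lemma ball_Zp_sets_haar [measurable]: "ball_Zp p k a \<in> sets (Zp_haar p)"
  by (simp add: sets_Zp_haar ball_Zp_sets[OF p])

lemma emeasure_Zp_haar_ball:
  "a \<in> {0..<int p ^ k} \<Longrightarrow> emeasure (Zp_haar p) (ball_Zp p k a) = ennreal (1 / real p ^ k)"
  by (rule emeasure_normalized_haar_ball[OF p normalized_haar_Zp_haar[OF p]])

lemma measure_Zp_haar_ball:
  "a \<in> {0..<int p ^ k} \<Longrightarrow> measure (Zp_haar p) (ball_Zp p k a) = 1 / real p ^ k"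
  using emeasure_Zp_haar_ball[of a k] by (simp add: measure_def)

lemma measurable_Zp_nth [measurable]: "(\<lambda>x. x k) \<in> measurable (Zp_haar p) (count_space UNIV)"
proof -
  have "(\<lambda>x. x k) -` {a} \<inter> space (Zp_haar p) = ball_Zp p k a" for a
    by (auto simp: ball_Zp_def[OF p] space_Zp_haar)
  then show ?thesis by (simp add: measurable_count_space_eq2_countable)
qed

text \<open>Residues take countably many values, so the two residues may be fixed one after the
  other, leaving only constants to be measured.\<close>

lemma measurable_Zp_pair_nth:
  "(\<lambda>w. h (fst w k) (snd w k)) \<in> measurable (Zp_haar p \<Otimes>\<^sub>M Zp_haar p) (count_space UNIV)"
proof -
  have "(\<lambda>w. (\<lambda>i w. (\<lambda>j w. h i j) (snd w k) w) (fst w k) w)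
      \<in> measurable (Zp_haar p \<Otimes>\<^sub>M Zp_haar p) (count_space UNIV)"
    by (rule measurable_compose_countable[OF measurable_compose_countable[OF measurable_const]
        measurable_compose[OF measurable_fst measurable_Zp_nth]])
      (simp_all add: measurable_compose[OF measurable_snd measurable_Zp_nth])
  then show ?thesis by simp
qed

lemma prob_space_Zp_pair: "prob_space (Zp_haar p \<Otimes>\<^sub>M Zp_haar p)"
proof -
  interpret H: prob_space "Zp_haar p" by (rule prob_space_Zp_haar)
  interpret pair_prob_space "Zp_haar p" "Zp_haar p" by unfold_locales
  show ?thesis by unfold_locales
qed

lemma measure_Zp_pair_Times:
  assumes "A \<in> sets (Zp_haar p)" "B \<in> sets (Zp_haar p)"
  shows "measure (Zp_haar p \<Otimes>\<^sub>M Zp_haar p) (A \<times> B) = measure (Zp_haar p) A * measure (Zp_haar p) B"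
proof -
  interpret H: prob_space "Zp_haar p" by (rule prob_space_Zp_haar)
  show ?thesis using H.emeasure_pair_measure_Times[OF assms] by (simp add: measure_def enn2real_mult)
qed

text \<open>The set is a disjoint union of products of two balls, one for each element of
  \<open>T\<close> and each of measure p^(-2k). Measures thereby become counts of residue
  pairs.\<close>

lemma measure_Zp_pair_cylinder:
  assumes T: "T \<subseteq> {0..<int p ^ k} \<times> {0..<int p ^ k}"
  shows "measure (Zp_haar p \<Otimes>\<^sub>M Zp_haar p) {w \<in> carrier (Zp p) \<times> carrier (Zp p). (fst w k, snd w k) \<in> T}
    = real (card T) / real p ^ (2 * k)"
proof -
  interpret prob_space "Zp_haar p \<Otimes>\<^sub>M Zp_haar p" by (rule prob_space_Zp_pair)
  have "{w \<in> carrier (Zp p) \<times> carrier (Zp p). (fst w k, snd w k) \<in> T}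
      = (\<Union>c\<in>T. ball_Zp p k (fst c) \<times> ball_Zp p k (snd c))"
    by (auto simp: ball_Zp_def[OF p])
  also have "prob \<dots> = (\<Sum>c\<in>T. prob (ball_Zp p k (fst c) \<times> ball_Zp p k (snd c)))"
  proof (intro finite_measure_finite_Union)
    show "disjoint_family_on (\<lambda>c. ball_Zp p k (fst c) \<times> ball_Zp p k (snd c)) T"
      by (auto simp: disjoint_family_on_def ball_Zp_def[OF p])
    show "finite T" using T by (rule finite_subset) simp
    show "(\<lambda>c. ball_Zp p k (fst c) \<times> ball_Zp p k (snd c)) ` T \<subseteq> events"
      by (intro image_subsetI pair_measureI ball_Zp_sets_haar)
  qed
  also have "\<dots> = (\<Sum>c\<in>T. 1 / real p ^ (2 * k))"
  proof (rule sum.cong)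
    fix c assume "c \<in> T"
    then have "fst c \<in> {0..<int p ^ k}" "snd c \<in> {0..<int p ^ k}" using T by auto
    then show "prob (ball_Zp p k (fst c) \<times> ball_Zp p k (snd c)) = 1 / real p ^ (2 * k)"
      by (simp add: measure_Zp_pair_Times measure_Zp_haar_ball mult_2 power_add)
  qed simp
  finally show ?thesis by simp
qed

text \<open>The integrand is expanded over the sets where \<open>F\<close> has a given order, and
  the series is integrated term by term. This is legitimate because |t| < 1 gives a geometric
  majorant on a probability space.\<close>

lemma set_integral_abs_powr_sums:
  fixes F :: "'a \<Rightarrow> nat \<Rightarrow> int"
  assumes M: "prob_space M" and s: "Re s > 0" and S [measurable]: "S \<in> sets M"
    and F: "\<And>w. w \<in> space M \<Longrightarrow> F w \<in> carrier (Zp p)"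
    and [measurable]: "\<And>k. (\<lambda>w. F w k) \<in> measurable M (count_space UNIV)"
  shows "set_integrable M S (\<lambda>w. abs_powr p s (F w))"
    and "(\<lambda>k. of_real (measure M {w \<in> S. F w k = 0} - measure M {w \<in> S. F w (Suc k) = 0})
      * (of_nat p powr (- s)) ^ k)
      sums (LINT w:S|M. abs_powr p s (F w))"
proof -
  interpret prob_space M by (rule M)
  define t where "t = (of_nat p powr (- s) :: complex)"
  have t: "norm t < 1" unfolding t_def by (rule norm_powr_neg_less_1[OF s])
  have S': "w \<in> space M" if "w \<in> S" for w using that sets.sets_into_space[OF S] by blast
  have A [measurable]: "{w \<in> S. F w k = 0} \<in> sets M" for k
  proof -
    have "{w \<in> S. F w k = 0} = {w \<in> space M. w \<in> S \<and> F w k = 0}" using S' by blast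
    then show ?thesis by simp
  qed
  \<comment> \<open>On \<open>E k\<close> the order of \<open>F w\<close> is exactly k. The two sets
    are nested, so the measure of \<open>E k\<close> is the difference of theirs.\<close>
  define E where "E k = {w \<in> S. F w k = 0} - {w \<in> S. F w (Suc k) = 0}" for k
  have E [measurable]: "E k \<in> sets M" for k unfolding E_def by (intro sets.Diff A)
  define f where "f k w = indicator (E k) w *\<^sub>R t ^ k" for k w
  have int: "integrable M (f k)" for k
    unfolding f_def by (intro integrable_scaleR_left) (simp add: less_top[symmetric] E)
  have val: "integral\<^sup>L M (f k)
      = of_real (measure M {w \<in> S. F w k = 0} - measure M {w \<in> S. F w (Suc k) = 0}) * t ^ k" for k
  proof -
    have "{w \<in> S. F w (Suc k) = 0} \<subseteq> {w \<in> S. F w k = 0}"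
      using Zp_nth_zero_mono[OF F, of _ k "Suc k"] S' by auto
    then have "prob (E k) = prob {w \<in> S. F w k = 0} - prob {w \<in> S. F w (Suc k) = 0}"
      unfolding E_def by (intro finite_measure_Diff A)
    then show ?thesis unfolding f_def by (simp add: scaleR_conv_of_real E)
  qed
  have sums: "(\<lambda>k. f k w) sums (indicator S w *\<^sub>R abs_powr p s (F w))" if "w \<in> space M" for w
  proof (cases "w \<in> S")
    case True
    then have "f k w = of_bool (F w k = 0 \<and> F w (Suc k) \<noteq> 0) * t ^ k" for k
      by (auto simp: f_def E_def indicator_def)
    then show ?thesis using abs_powr_sums[OF F[OF that], of s] True by (simp add: t_def)
  qed (simp add: f_def E_def)
  have norm_f: "norm (f k w) \<le> norm t ^ k" for k w
    by (simp add: f_def norm_power indicator_def)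
  have "AE w in M. summable (\<lambda>k. norm (f k w))"
    by (intro AE_I2 summable_comparison_test'[OF summable_geometric[of "norm t"]])
       (use t norm_f in auto)
  moreover have "summable (\<lambda>k. \<integral>w. norm (f k w) \<partial>M)"
  proof (rule summable_comparison_test'[OF summable_geometric[of "norm t"]])
    fix k
    have "(\<integral>w. norm (f k w) \<partial>M) \<le> (\<integral>w. norm t ^ k \<partial>M)"
      using norm_f int by (intro integral_mono) auto
    then show "norm (\<integral>w. norm (f k w) \<partial>M) \<le> norm t ^ k" by (simp add: prob_space)
  qed (use t in simp)
  ultimately have *: "integrable M (\<lambda>w. \<Sum>k. f k w)"
      "(\<lambda>k. integral\<^sup>L M (f k)) sums (\<integral>w. (\<Sum>k. f k w) \<partial>M)"
    using int by (intro integrable_suminf sums_integral; simp)+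
  have eq: "(\<Sum>k. f k w) = indicator S w *\<^sub>R abs_powr p s (F w)" if "w \<in> space M" for w
    using sums[OF that] by (simp add: sums_iff)
  show "set_integrable M S (\<lambda>w. abs_powr p s (F w))"
    unfolding set_integrable_def using *(1) eq by (simp cong: Bochner_Integration.integrable_cong)
  show "(\<lambda>k. of_real (measure M {w \<in> S. F w k = 0} - measure M {w \<in> S. F w (Suc k) = 0})
      * (of_nat p powr (- s)) ^ k)
      sums (LINT w:S|M. abs_powr p s (F w))"
    unfolding set_lebesgue_integral_def using *(2) eq
    by (simp add: val t_def cong: Bochner_Integration.integral_cong)
qed

end

section \<open>Scaling\<close>

text \<open>Multiplication by p^a in the p-adic integers, written on residues.\<close>

definition Zp_scale :: "nat \<Rightarrow> nat \<Rightarrow> (nat \<Rightarrow> int) \<Rightarrow> nat \<Rightarrow> int" where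
  "Zp_scale p a x = (\<lambda>k. int p ^ a * x k mod int p ^ k)"

context
  fixes p :: nat
  assumes p: "p > 1"
begin

lemma Zp_scale_closed: "x \<in> carrier (Zp p) \<Longrightarrow> Zp_scale p a x \<in> carrier (Zp p)"
  unfolding Zp_scale_def by (intro Zp_memI[OF p] mod_mult_cong Zp_Suc[OF p] refl)

text \<open>At level a + k the reduction changes nothing, because \<open>int p ^ a * x k\<close> is
  already below p^(a+k). The shifted index thus removes the modulus from the definition.\<close>

lemma Zp_scale_add_nth:
  assumes "x \<in> carrier (Zp p)"
  shows "Zp_scale p a x (a + k) = int p ^ a * x k"
  using Zp_mod[OF p assms, of k "a + k"] by (simp add: Zp_scale_def power_add mult_mod_right[symmetric])

lemma abs_powr_scale:
  assumes z: "z \<in> carrier (Zp p)"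
  shows "abs_powr p s (Zp_scale p a z) = (of_nat p powr (- s)) ^ a * abs_powr p s z"
proof (cases "z = \<zero>\<^bsub>Zp p\<^esub>")
  case True
  then have "Zp_scale p a z = \<zero>\<^bsub>Zp p\<^esub>" by (simp add: Zp_scale_def Zp_simps(5)[OF p])
  then show ?thesis by (simp add: True abs_powr_zero[OF p])
next
  case False
  then obtain k' where "z k' \<noteq> 0" by (auto simp: Zp_simps(5)[OF p])
  then obtain k where k: "z k = 0" "z (Suc k) \<noteq> 0" using ex_level_below[OF p z] by blast
  have "Zp_scale p a z (a + k) = 0" "Zp_scale p a z (Suc (a + k)) \<noteq> 0"
    using Zp_scale_add_nth[OF z, of a k] Zp_scale_add_nth[OF z, of a "Suc k"] k p by auto
  then show ?thesis
    using abs_powr_level[OF p Zp_scale_closed[OF z]] abs_powr_level[OF p z k] by (simp add: power_add)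
qed

lemma measurable_Zp_scale [measurable]: "Zp_scale p a \<in> measurable (Zp_haar p) (Zp_haar p)"
proof -
  have "Zp_scale p a \<in> measurable (Zp_haar p) (Zp_borel p)"
  proof (rule measurable_sigma_sets[OF sets_Zp_borel[OF p] balls_Zp_subset[OF p]])
    show "Zp_scale p a \<in> space (Zp_haar p) \<rightarrow> carrier (Zp p)"
      using Zp_scale_closed by (auto simp: space_Zp_haar[OF p])
    fix B assume "B \<in> balls_Zp p"
    then consider "B = {}" | k b where "B = ball_Zp p k b" by (auto simp: balls_Zp_def[OF p])
    then show "Zp_scale p a -` B \<inter> space (Zp_haar p) \<in> sets (Zp_haar p)"
    proof cases
      case 2
      have "(\<lambda>x. int p ^ a * x k mod int p ^ k) \<in> measurable (Zp_haar p) (count_space UNIV)"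
        by (rule measurable_compose[OF measurable_Zp_nth[OF p]]) simp
      then have "(\<lambda>x. int p ^ a * x k mod int p ^ k) -` {b} \<inter> space (Zp_haar p) \<in> sets (Zp_haar p)"
        by (rule measurable_sets) simp
      moreover have "Zp_scale p a -` B \<inter> space (Zp_haar p)
          = (\<lambda>x. int p ^ a * x k mod int p ^ k) -` {b} \<inter> space (Zp_haar p)"
        using Zp_scale_closed by (auto simp: 2 ball_Zp_def[OF p] space_Zp_haar[OF p] Zp_scale_def)
      ultimately show ?thesis by simp
    qed simp
  qed
  then show ?thesis using measurable_cong_sets[OF refl sets_Zp_haar[OF p]] by blast
qed

text \<open>The image of multiplication by p^a is \<open>ball_Zp p a 0\<close>. Two balls are nested
  or disjoint, so the comparison splits according to whether the target ball is coarser or finer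
  than the image.\<close>

lemma emeasure_Zp_scale_ball:
  assumes b: "b \<in> {0..<int p ^ k}"
  shows "emeasure (Zp_haar p) (Zp_scale p a -` ball_Zp p k b \<inter> carrier (Zp p))
    = ennreal (real p ^ a) * emeasure (Zp_haar p) (ball_Zp p a 0 \<inter> ball_Zp p k b)"
proof -
  have ball0: "0 \<in> {0..<int p ^ j}" for j using p by simp
  have pre: "Zp_scale p a -` ball_Zp p k b \<inter> carrier (Zp p) = {x \<in> carrier (Zp p). Zp_scale p a x k = b}"
    using Zp_scale_closed by (auto simp: ball_Zp_def[OF p])
  have cancel: "ennreal (real p ^ a) * ennreal (1 / real p ^ (a + j)) = ennreal (1 / real p ^ j)" for j
    using p by (simp add: ennreal_mult[symmetric] power_add)
  show ?thesis
  proof (cases "k \<le> a")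
    case True
    \<comment> \<open>Modulo p^k the whole image is 0, so the preimage is everything for b = 0 and
      empty otherwise.\<close>
    have 1: "Zp_scale p a x k = 0" for x
      using True by (simp add: Zp_scale_def le_imp_power_dvd)
    have 2: "ball_Zp p a 0 \<subseteq> ball_Zp p k 0"
      using Zp_nth_zero_mono[OF p _ True] by (auto simp: ball_Zp_def[OF p])
    show ?thesis
    proof (cases "b = 0")
      case b: True
      have "Zp_scale p a -` ball_Zp p k b \<inter> carrier (Zp p) = ball_Zp p 0 0"
        unfolding pre by (auto simp: 1 b ball_Zp_def[OF p] Zp_nth_0[OF p])
      moreover have "ball_Zp p a 0 \<inter> ball_Zp p k b = ball_Zp p a 0" using 2 b by blast
      ultimately show ?thesis
        using cancel[of 0] emeasure_Zp_haar_ball[OF p ball0] by simp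
    next
      case b: False
      have "ball_Zp p a 0 \<inter> ball_Zp p k b = {}" using 2 b by (auto simp: ball_Zp_def[OF p])
      then show ?thesis using b by (simp add: pre 1)
    qed
  next
    case False
    \<comment> \<open>The target ball is finer than the image. It lies inside the image if p^a
      divides b, and then its preimage is a ball of level j; otherwise it misses the image.\<close>
    then obtain j where k: "k = a + j" by (metis le_add_diff_inverse nat_le_linear)
    have pre': "Zp_scale p a -` ball_Zp p k b \<inter> carrier (Zp p) = {x \<in> carrier (Zp p). int p ^ a * x j = b}"
      unfolding pre unfolding k by (auto simp: Zp_scale_add_nth)
    show ?thesis
    proof (cases "int p ^ a dvd b")
      case True
      then obtain c where c: "b = int p ^ a * c" by blast
      have "int p ^ a > 0" using p by simp
      then have "0 \<le> c" using b mult_pos_neg[of "int p ^ a" c] by (force simp: c)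
      then have cb: "c \<in> {0..<int p ^ j}" using b p by (auto simp: c k power_add)
      have "Zp_scale p a -` ball_Zp p k b \<inter> carrier (Zp p) = ball_Zp p j c"
        unfolding pre' using p by (auto simp: c ball_Zp_def[OF p])
      moreover have "ball_Zp p a 0 \<inter> ball_Zp p k b = ball_Zp p k b"
        using Zp_dvd_nth_iff[OF p, of _ a k] True by (auto simp: k ball_Zp_def[OF p])
      ultimately show ?thesis
        using emeasure_Zp_haar_ball[OF p b] emeasure_Zp_haar_ball[OF p cb] cancel by (simp add: k)
    next
      case False
      have "{x \<in> carrier (Zp p). int p ^ a * x j = b} = {}" using False by auto
      moreover have "ball_Zp p a 0 \<inter> ball_Zp p k b = {}"
        using Zp_dvd_nth_iff[OF p, of _ a k] False by (auto simp: k ball_Zp_def[OF p])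
      ultimately show ?thesis by (simp only: pre' emeasure_empty mult_zero_right)
    qed
  qed
qed

text \<open>Finite measures that agree on balls coincide, so the ball computation suffices. This is
  the one-variable change of variables formula as an identity of measures.\<close>

lemma distr_Zp_scale:
  "distr (Zp_haar p) (Zp_haar p) (Zp_scale p a)
    = density (Zp_haar p) (\<lambda>x. ennreal (real p ^ a * indicator (ball_Zp p a 0) x))" (is "?L = ?R")
proof (rule Zp_measure_eqI[OF p])
  interpret prob_space "Zp_haar p" by (rule prob_space_Zp_haar[OF p])
  show "sets ?L = sets (Zp_borel p)" "sets ?R = sets (Zp_borel p)"
    by (simp_all add: sets_Zp_haar[OF p])
  have "prob_space ?L" by (rule prob_space_distr[OF measurable_Zp_scale])
  then have "emeasure ?L (space ?L) = 1" by (rule prob_space.emeasure_space_1)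
  then show "emeasure ?L (carrier (Zp p)) \<noteq> \<infinity>" by (simp add: space_Zp_haar[OF p])
  fix k b assume b: "b \<in> {0..<int p ^ k}"
  note [measurable] = ball_Zp_sets_haar[OF p]
  have "emeasure ?R (ball_Zp p k b)
      = (\<integral>\<^sup>+x. ennreal (real p ^ a) * indicator (ball_Zp p a 0 \<inter> ball_Zp p k b) x \<partial>Zp_haar p)"
    by (subst emeasure_density) (auto intro!: nn_integral_cong split: split_indicator)
  also have "\<dots> = ennreal (real p ^ a) * emeasure (Zp_haar p) (ball_Zp p a 0 \<inter> ball_Zp p k b)"
    by (intro nn_integral_cmult_indicator) simp
  also have "\<dots> = emeasure ?L (ball_Zp p k b)"
    using emeasure_Zp_scale_ball[OF b] by (simp add: emeasure_distr space_Zp_haar[OF p])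
  finally show "emeasure ?L (ball_Zp p k b) = emeasure ?R (ball_Zp p k b)" by simp
qed

text \<open>The pushforward of the product measure is the product of the pushforwards, and their
  densities multiply to p^(a+b) on the product of the two images.\<close>

lemma set_integral_Zp_scale:
  fixes f :: "(nat \<Rightarrow> int) \<times> (nat \<Rightarrow> int) \<Rightarrow> complex"
  assumes f [measurable]: "f \<in> borel_measurable (Zp_haar p \<Otimes>\<^sub>M Zp_haar p)"
  shows "(LINT w|(Zp_haar p \<Otimes>\<^sub>M Zp_haar p). f (Zp_scale p a (fst w), Zp_scale p b (snd w)))
    = of_nat p ^ (a + b) * (LINT w:ball_Zp p a 0 \<times> ball_Zp p b 0|(Zp_haar p \<Otimes>\<^sub>M Zp_haar p). f w)"
proof -
  interpret H: prob_space "Zp_haar p" by (rule prob_space_Zp_haar[OF p])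
  let ?H = "Zp_haar p" and ?H2 = "Zp_haar p \<Otimes>\<^sub>M Zp_haar p"
  note [measurable] = ball_Zp_sets_haar[OF p]
  have prob: "prob_space (distr ?H ?H (Zp_scale p c))" for c
    by (rule H.prob_space_distr[OF measurable_Zp_scale])
  then have sf: "sigma_finite_measure (distr ?H ?H (Zp_scale p c))" for c
    by (rule prob_space_imp_sigma_finite)
  have "distr ?H2 ?H2 (\<lambda>(x, y). (Zp_scale p a x, Zp_scale p b y))
      = distr ?H ?H (Zp_scale p a) \<Otimes>\<^sub>M distr ?H ?H (Zp_scale p b)"
    by (rule pair_measure_distr[OF measurable_Zp_scale measurable_Zp_scale sf, symmetric])
  also have "\<dots> = density ?H2 (\<lambda>(x, y). ennreal (real p ^ a * indicator (ball_Zp p a 0) x)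
      * ennreal (real p ^ b * indicator (ball_Zp p b 0) y))"
    unfolding distr_Zp_scale
    using sf[of b] H.sigma_finite_measure_axioms by (intro pair_measure_density) (simp_all add: distr_Zp_scale)
  also have "\<dots> = density ?H2 (\<lambda>w. ennreal (real p ^ (a + b) * indicator (ball_Zp p a 0 \<times> ball_Zp p b 0) w))"
    by (intro arg_cong[of _ _ "density ?H2"])
       (auto simp: fun_eq_iff indicator_def ennreal_mult[symmetric] power_add)
  finally have eq: "distr ?H2 ?H2 (\<lambda>(x, y). (Zp_scale p a x, Zp_scale p b y))
    = density ?H2 (\<lambda>w. ennreal (real p ^ (a + b) * indicator (ball_Zp p a 0 \<times> ball_Zp p b 0) w))" .
  have "(LINT w|?H2. f (Zp_scale p a (fst w), Zp_scale p b (snd w)))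
      = (LINT w|distr ?H2 ?H2 (\<lambda>(x, y). (Zp_scale p a x, Zp_scale p b y)). f w)"
    by (subst integral_distr) (simp_all add: case_prod_beta)
  also have "\<dots> = (LINT w|?H2. (real p ^ (a + b) * indicator (ball_Zp p a 0 \<times> ball_Zp p b 0) w) *\<^sub>R f w)"
    unfolding eq by (rule integral_density) auto
  also have "\<dots> = of_nat p ^ (a + b) * (LINT w:ball_Zp p a 0 \<times> ball_Zp p b 0|?H2. f w)"
    unfolding set_lebesgue_integral_def
    by (simp add: scaleR_scaleR[symmetric] del: scaleR_scaleR) (simp add: scaleR_conv_of_real)
  finally show ?thesis .
qed

end

section \<open>Decomposition of the plane\<close>

definition Zp_binomial :: "nat \<Rightarrow> nat \<Rightarrow> nat \<Rightarrow> (nat \<Rightarrow> int) \<times> (nat \<Rightarrow> int) \<Rightarrow> nat \<Rightarrow> int" where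
  "Zp_binomial p n m w = fst w [^]\<^bsub>Zp p\<^esub> n \<oplus>\<^bsub>Zp p\<^esub> snd w [^]\<^bsub>Zp p\<^esub> m"

definition Zp_sphere :: "nat \<Rightarrow> nat \<Rightarrow> (nat \<Rightarrow> int) set" where
  "Zp_sphere p a = {x \<in> carrier (Zp p). x a = 0 \<and> x (Suc a) \<noteq> 0}"

text \<open>Writing x = p^a c with c prime to p shows that x^n has exact order n a. Adding a term of
  strictly higher order leaves this order unchanged.\<close>

lemma prime_power_exact_dvd_add:
  fixes p n a :: nat and x y :: int
  assumes p: "prime p" and x: "int p ^ a dvd x" "\<not> int p ^ Suc a dvd x" and y: "int p ^ Suc (n * a) dvd y"
  shows "int p ^ (n * a) dvd x ^ n + y" "\<not> int p ^ Suc (n * a) dvd x ^ n + y"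
proof -
  obtain c where c: "x = int p ^ a * c" using x by blast
  have p0: "int p \<noteq> 0" using p by auto
  have xn: "x ^ n = int p ^ (n * a) * c ^ n"
    by (simp add: c power_mult_distrib power_mult mult.commute)
  have "\<not> int p dvd c" using x(2) p0 by (simp add: c)
  then have "\<not> int p dvd c ^ n" using p prime_dvd_power[of "int p"] by auto
  then have "\<not> int p ^ Suc (n * a) dvd x ^ n" using p0 by (simp add: xn)
  then show "\<not> int p ^ Suc (n * a) dvd x ^ n + y" using y by (simp only: dvd_add_left_iff) simp
  have "int p ^ (n * a) dvd y" using y by (rule power_le_dvd) simp
  then show "int p ^ (n * a) dvd x ^ n + y" by (simp add: xn)
qed

lemma set_integral_eq_const:
  fixes c :: complex
  assumes "prob_space M" "A \<in> sets M" "\<And>w. w \<in> A \<Longrightarrow> f w = c"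
  shows "(LINT w:A|M. f w) = of_real (measure M A) * c"
proof -
  interpret prob_space M by fact
  have "(LINT w:A|M. f w) = (LINT w:A|M. c)"
    using assms(3) by (intro set_lebesgue_integral_cong assms(2)) auto
  then show ?thesis using assms(2) by (simp add: set_lebesgue_integral_def scaleR_conv_of_real)
qed

context
  fixes p :: nat
  assumes prime: "prime p"
begin

lemma p_gt_1: "p > 1"
  using prime by (rule prime_gt_1_nat)

lemma Zp_binomial_nth: "Zp_binomial p n m w k = (fst w k ^ n + snd w k ^ m) mod int p ^ k"
  unfolding Zp_binomial_def by (rule Zp_pow_add_nth[OF p_gt_1])

lemma Zp_binomial_nth_zero_iff:
  "Zp_binomial p n m w k = 0 \<longleftrightarrow> int p ^ k dvd fst w k ^ n + snd w k ^ m"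
  by (simp add: Zp_binomial_nth dvd_eq_mod_eq_0)

lemma Zp_binomial_closed:
  "w \<in> carrier (Zp p) \<times> carrier (Zp p) \<Longrightarrow> Zp_binomial p n m w \<in> carrier (Zp p)"
  unfolding Zp_binomial_def
  by (intro Zp_add_closed[OF p_gt_1] Zp_pow_closed[OF p_gt_1]) auto

lemma Zp_binomial_swap: "Zp_binomial p m n (y, x) = Zp_binomial p n m (x, y)"
  by (simp add: fun_eq_iff Zp_binomial_nth add.commute)

lemma measurable_Zp_binomial:
  "(\<lambda>w. Zp_binomial p n m w k) \<in> measurable (Zp_haar p \<Otimes>\<^sub>M Zp_haar p) (count_space UNIV)"
  unfolding Zp_binomial_nth by (rule measurable_Zp_pair_nth[OF p_gt_1])

lemma space_Zp_pair: "space (Zp_haar p \<Otimes>\<^sub>M Zp_haar p) = carrier (Zp p) \<times> carrier (Zp p)"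
  by (simp add: space_pair_measure space_Zp_haar[OF p_gt_1])

lemma set_integrable_Zp_binomial:
  assumes "Re s > 0" "S \<in> sets (Zp_haar p \<Otimes>\<^sub>M Zp_haar p)"
  shows "set_integrable (Zp_haar p \<Otimes>\<^sub>M Zp_haar p) S (\<lambda>w. abs_powr p s (Zp_binomial p n m w))"
  by (rule set_integral_abs_powr_sums(1)[OF p_gt_1 prob_space_Zp_pair[OF p_gt_1] assms _ measurable_Zp_binomial])
     (simp add: space_Zp_pair Zp_binomial_closed)

lemma integrable_Zp_binomial:
  assumes s: "Re s > 0"
  shows "integrable (Zp_haar p \<Otimes>\<^sub>M Zp_haar p) (\<lambda>w. abs_powr p s (Zp_binomial p n m w))"
  using set_integrable_Zp_binomial[OF s sets.top, of n m]
  unfolding set_integrable_def by (rule Bochner_Integration.integrable_cong[THEN iffD1, rotated -1]) simp_all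

text \<open>Weighted homogeneity: x^n gains the factor p^(n a) and y^m the factor p^(m b), and these
  agree.\<close>

lemma Zp_binomial_scale:
  assumes w: "w \<in> carrier (Zp p) \<times> carrier (Zp p)" and ab: "n * a = m * b"
  shows "Zp_binomial p n m (Zp_scale p a (fst w), Zp_scale p b (snd w)) = Zp_scale p (n * a) (Zp_binomial p n m w)"
proof
  fix k
  have "Zp_binomial p n m (Zp_scale p a (fst w), Zp_scale p b (snd w)) k
      = ((int p ^ a * fst w k) ^ n + (int p ^ b * snd w k) ^ m) mod int p ^ k"
    unfolding Zp_binomial_nth Zp_scale_def fst_conv snd_conv by (metis mod_add_eq power_mod)
  also have "(int p ^ a * fst w k) ^ n + (int p ^ b * snd w k) ^ m
      = int p ^ (a * n) * fst w k ^ n + int p ^ (b * m) * snd w k ^ m"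
    by (simp add: power_mult_distrib power_mult)
  also have "\<dots> = int p ^ (n * a) * (fst w k ^ n + snd w k ^ m)"
    using ab by (simp add: algebra_simps)
  also have "\<dots> mod int p ^ k = Zp_scale p (n * a) (Zp_binomial p n m w) k"
    by (simp add: Zp_scale_def Zp_binomial_nth mod_mult_right_eq)
  finally show "Zp_binomial p n m (Zp_scale p a (fst w), Zp_scale p b (snd w)) k
      = Zp_scale p (n * a) (Zp_binomial p n m w) k" .
qed

text \<open>The order of y^m exceeds that of x^n, so the sum has the order of x^n.\<close>

lemma abs_powr_Zp_binomial_dominant:
  assumes x: "x \<in> Zp_sphere p a" and y: "y \<in> ball_Zp p (Suc (n * a div m)) 0" and mn: "m > 0" "n > 0"
  shows "abs_powr p s (Zp_binomial p n m (x, y)) = (of_nat p powr (- s)) ^ (n * a)"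
proof (rule abs_powr_level[OF p_gt_1])
  have xc: "x \<in> carrier (Zp p)" "x a = 0" "x (Suc a) \<noteq> 0" using x by (auto simp: Zp_sphere_def)
  \<comment> \<open>The least order b of y with m b > n a.\<close>
  define b where "b = Suc (n * a div m)"
  have yc: "y \<in> carrier (Zp p)" "y b = 0" using y by (auto simp: ball_Zp_def[OF p_gt_1] b_def)
  show "Zp_binomial p n m (x, y) \<in> carrier (Zp p)" using xc yc by (simp add: Zp_binomial_closed)
  \<comment> \<open>One level beyond the expected order n a, where the sum must stop vanishing. As b
    and \<open>Suc a\<close> are at most k, the residues at level k still show the orders of x and
    y.\<close>
  define k where "k = Suc (n * a)"
  have "n * a < m * b" using mn dividend_less_times_div[of m "n * a"] by (simp add: b_def)
  then have kb: "k \<le> b * m" by (simp add: k_def mult.commute)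
  have "b \<le> k" "Suc a \<le> k" using mn by (simp_all add: b_def k_def)
  then have "int p ^ a dvd x k" "\<not> int p ^ Suc a dvd x k" "int p ^ b dvd y k"
    using xc yc by (simp_all add: Zp_dvd_nth_iff[OF p_gt_1] del: power_Suc)
  moreover have "int p ^ k dvd y k ^ m"
  proof -
    have "int p ^ (b * m) dvd y k ^ m"
      using \<open>int p ^ b dvd y k\<close> by (simp add: power_mult dvd_power_same)
    then show ?thesis using kb by (rule power_le_dvd)
  qed
  ultimately have *: "int p ^ (n * a) dvd x k ^ n + y k ^ m" "\<not> int p ^ Suc (n * a) dvd x k ^ n + y k ^ m"
    using prime_power_exact_dvd_add[OF prime, of a "x k" n "y k ^ m"] by (simp_all only: k_def not_False_eq_True)
  show "Zp_binomial p n m (x, y) (Suc (n * a)) \<noteq> 0"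
    using *(2) by (simp only: Zp_binomial_nth_zero_iff k_def fst_conv snd_conv not_False_eq_True)
  have "Zp_binomial p n m (x, y) k mod int p ^ (n * a) = (x k ^ n + y k ^ m) mod int p ^ (n * a)"
    unfolding Zp_binomial_nth fst_conv snd_conv by (rule mod_mod_cancel) (simp add: k_def)
  also have "\<dots> = 0" using *(1) by simp
  finally show "Zp_binomial p n m (x, y) (n * a) = 0"
    using Zp_mod[OF p_gt_1 Zp_binomial_closed, of "(x, y)" "n * a" k n m] xc yc by (simp add: k_def)
qed

section \<open>Integrals over the single cells\<close>

lemma Zp_sphere_eq: "Zp_sphere p a = ball_Zp p a 0 - ball_Zp p (Suc a) 0"
  by (auto simp: Zp_sphere_def ball_Zp_def[OF p_gt_1])

lemma Zp_sphere_sets [measurable]: "Zp_sphere p a \<in> sets (Zp_haar p)"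
  unfolding Zp_sphere_eq by (intro sets.Diff ball_Zp_sets_haar[OF p_gt_1])

lemma measure_Zp_sphere: "measure (Zp_haar p) (Zp_sphere p a) = (1 - 1 / real p) / real p ^ a"
proof -
  interpret prob_space "Zp_haar p" by (rule prob_space_Zp_haar[OF p_gt_1])
  have b: "0 \<in> {0..<int p ^ k}" for k using p_gt_1 by simp
  have "ball_Zp p (Suc a) 0 \<subseteq> ball_Zp p a 0"
    using Zp_nth_zero_mono[OF p_gt_1, of _ a "Suc a"] by (auto simp: ball_Zp_def[OF p_gt_1])
  then have "prob (Zp_sphere p a) = prob (ball_Zp p a 0) - prob (ball_Zp p (Suc a) 0)"
    unfolding Zp_sphere_eq by (intro finite_measure_Diff ball_Zp_sets_haar[OF p_gt_1])
  then show ?thesis using p_gt_1 measure_Zp_haar_ball[OF p_gt_1 b] by (simp add: field_simps)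
qed

text \<open>The integrand is constant on the cell, so the integral is that constant times the
  measure. The factor 1/p comes from the \<open>Suc\<close> in the level of the ball.\<close>

lemma set_integral_dominant_x:
  assumes "m > 0" "n > 0"
  shows "(LINT w:Zp_sphere p a \<times> ball_Zp p (Suc (n * a div m)) 0|(Zp_haar p \<Otimes>\<^sub>M Zp_haar p).
      abs_powr p s (Zp_binomial p n m w))
    = (1 - 1 / of_nat p) * (1 / of_nat p) * ((of_nat p powr (- s)) ^ (n * a) / of_nat p ^ (n * a div m + a))"
proof -
  have "0 \<in> {0..<int p ^ k}" for k using p_gt_1 by simp
  then have "measure (Zp_haar p \<Otimes>\<^sub>M Zp_haar p) (Zp_sphere p a \<times> ball_Zp p (Suc (n * a div m)) 0)
      = (1 - 1 / real p) / real p ^ a * (1 / real p ^ Suc (n * a div m))"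
    by (simp only: measure_Zp_pair_Times[OF p_gt_1] Zp_sphere_sets ball_Zp_sets_haar[OF p_gt_1]
        measure_Zp_sphere measure_Zp_haar_ball[OF p_gt_1])
  moreover have "abs_powr p s (Zp_binomial p n m w) = (of_nat p powr (- s)) ^ (n * a)"
    if "w \<in> Zp_sphere p a \<times> ball_Zp p (Suc (n * a div m)) 0" for w
    using that abs_powr_Zp_binomial_dominant[OF _ _ assms] by auto
  ultimately show ?thesis
    by (subst set_integral_eq_const[OF prob_space_Zp_pair[OF p_gt_1]])
       (auto intro!: Zp_sphere_sets ball_Zp_sets_haar[OF p_gt_1] simp: power_add)
qed

lemma set_integral_dominant_y:
  assumes "m > 0" "n > 0"
  shows "(LINT w:ball_Zp p (Suc (m * b div n)) 0 \<times> Zp_sphere p b|(Zp_haar p \<Otimes>\<^sub>M Zp_haar p).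
      abs_powr p s (Zp_binomial p n m w))
    = (1 - 1 / of_nat p) * (1 / of_nat p) * ((of_nat p powr (- s)) ^ (m * b) / of_nat p ^ (m * b div n + b))"
proof -
  have "0 \<in> {0..<int p ^ k}" for k using p_gt_1 by simp
  then have "measure (Zp_haar p \<Otimes>\<^sub>M Zp_haar p) (ball_Zp p (Suc (m * b div n)) 0 \<times> Zp_sphere p b)
      = (1 / real p ^ Suc (m * b div n)) * ((1 - 1 / real p) / real p ^ b)"
    by (simp only: measure_Zp_pair_Times[OF p_gt_1] Zp_sphere_sets ball_Zp_sets_haar[OF p_gt_1]
        measure_Zp_sphere measure_Zp_haar_ball[OF p_gt_1])
  moreover have "abs_powr p s (Zp_binomial p n m w) = (of_nat p powr (- s)) ^ (m * b)"
    if "w \<in> ball_Zp p (Suc (m * b div n)) 0 \<times> Zp_sphere p b" for w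
    using that abs_powr_Zp_binomial_dominant[OF _ _ assms(2,1)]
    by (cases w) (auto simp: Zp_binomial_swap[of n m])
  ultimately show ?thesis
    by (subst set_integral_eq_const[OF prob_space_Zp_pair[OF p_gt_1]])
       (auto intro!: Zp_sphere_sets ball_Zp_sets_haar[OF p_gt_1] simp: power_add)
qed

text \<open>There are p^k root pairs modulo p^(k+1) above (u, v), each contributing
  p^(-2(k+1)).\<close>

lemma measure_smooth_cell_level:
  assumes mn: "\<not> (p dvd m \<and> p dvd n)"
    and u: "u \<in> {1..<int p}" and v: "v \<in> {1..<int p}" and uv: "int p dvd u ^ n + v ^ m"
  shows "measure (Zp_haar p \<Otimes>\<^sub>M Zp_haar p)
      {w \<in> ball_Zp p 1 u \<times> ball_Zp p 1 v. Zp_binomial p n m w (Suc k) = 0} = 1 / real p ^ (k + 2)"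
proof -
  define T where "T = {(r, q) \<in> {0..<int p ^ Suc k} \<times> {0..<int p ^ Suc k}.
      r mod int p = u \<and> q mod int p = v \<and> int p ^ Suc k dvd r ^ n + q ^ m}"
  \<comment> \<open>Lying in the cell is visible at level k + 1, so the level set is a cylinder over
    residue pairs at that level.\<close>
  have red: "x 1 = x (Suc k) mod int p" if "x \<in> carrier (Zp p)" for x
    using Zp_mod[OF p_gt_1 that, of 1 "Suc k"] by simp
  have "{w \<in> ball_Zp p 1 u \<times> ball_Zp p 1 v. Zp_binomial p n m w (Suc k) = 0}
      = {w \<in> carrier (Zp p) \<times> carrier (Zp p). (fst w (Suc k), snd w (Suc k)) \<in> T}"
    unfolding Zp_binomial_nth_zero_iff
    using Zp_bounds[OF p_gt_1, of _ "Suc k"] red by (auto simp: ball_Zp_def[OF p_gt_1] T_def)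
  moreover have "T \<subseteq> {0..<int p ^ Suc k} \<times> {0..<int p ^ Suc k}" by (auto simp: T_def)
  moreover have "card T = p ^ k" unfolding T_def by (rule card_smooth_solutions[OF prime mn u v uv])
  ultimately show ?thesis
    using measure_Zp_pair_cylinder[OF p_gt_1, of T "Suc k"] p_gt_1 by (simp add: power_add mult_2)
qed

text \<open>From level 1 on the measures of the level sets fall by a factor p at each step, so the
  expansion by order is a geometric series of ratio t/p.\<close>

lemma set_integral_smooth_cell:
  assumes s: "Re s > 0" and mn: "\<not> (p dvd m \<and> p dvd n)"
    and u: "u \<in> {1..<int p}" and v: "v \<in> {1..<int p}" and uv: "int p dvd u ^ n + v ^ m"
  defines "t \<equiv> of_nat p powr (- s)"
  shows "(LINT w:ball_Zp p 1 u \<times> ball_Zp p 1 v|(Zp_haar p \<Otimes>\<^sub>M Zp_haar p). abs_powr p s (Zp_binomial p n m w))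
    = (1 - 1 / of_nat p) * t / of_nat p ^ 2 / (1 - t / of_nat p)" (is "?I = ?R")
proof -
  let ?H2 = "Zp_haar p \<Otimes>\<^sub>M Zp_haar p"
  define S where "S = ball_Zp p 1 u \<times> ball_Zp p 1 v"
  define \<mu> where "\<mu> k = measure ?H2 {w \<in> S. Zp_binomial p n m w k = 0}" for k
  have S: "S \<in> sets ?H2" unfolding S_def by (intro pair_measureI ball_Zp_sets_haar[OF p_gt_1])
  have Sc: "w \<in> carrier (Zp p) \<times> carrier (Zp p)" if "w \<in> S" for w
    using that by (auto simp: S_def ball_Zp_def[OF p_gt_1])
  have \<mu>: "\<mu> (Suc k) = 1 / real p ^ (k + 2)" for k
    unfolding \<mu>_def S_def by (rule measure_smooth_cell_level[OF mn u v uv])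
  have "Zp_binomial p n m w 0 = 0" "Zp_binomial p n m w (Suc 0) = 0" if "w \<in> S" for w
    using Zp_nth_0[OF p_gt_1 Zp_binomial_closed[OF Sc[OF that]]] uv that
    by (auto simp: Zp_binomial_nth_zero_iff S_def ball_Zp_def[OF p_gt_1])
  \<comment> \<open>On the whole cell the value is already divisible by p. The term of order 0
    therefore vanishes, and the series may be started at order 1.\<close>
  then have "\<mu> 0 = \<mu> (Suc 0)" unfolding \<mu>_def by (intro arg_cong[of _ _ "measure ?H2"]) auto
  moreover have "(\<lambda>k. of_real (\<mu> k - \<mu> (Suc k)) * t ^ k) sums ?I"
    unfolding \<mu>_def t_def S_def[symmetric]
    by (rule set_integral_abs_powr_sums(2)[OF p_gt_1 prob_space_Zp_pair[OF p_gt_1] s S _ measurable_Zp_binomial])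
       (simp add: space_Zp_pair Zp_binomial_closed)
  ultimately have "(\<lambda>k. of_real (\<mu> (Suc k) - \<mu> (Suc (Suc k))) * t ^ Suc k) sums ?I"
    by (subst sums_Suc_iff) simp
  also have "(\<lambda>k. of_real (\<mu> (Suc k) - \<mu> (Suc (Suc k))) * t ^ Suc k)
      = (\<lambda>k. (1 - 1 / of_nat p) * t / of_nat p ^ 2 * (t / of_nat p) ^ k)"
    using p_gt_1 by (simp add: fun_eq_iff \<mu> field_simps power2_eq_square)
  finally have "(\<lambda>k. (1 - 1 / of_nat p) * t / of_nat p ^ 2 * (t / of_nat p) ^ k) sums ?I" .
  moreover have "norm (t / of_nat p) < 1"
  proof -
    have "norm t < 1" unfolding t_def by (rule norm_powr_neg_less_1[OF p_gt_1 s])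
    also have "1 < real p" using p_gt_1 by simp
    finally show ?thesis using p_gt_1 by (simp add: norm_divide)
  qed
  then have "(\<lambda>k. (1 - 1 / of_nat p) * t / of_nat p ^ 2 * (t / of_nat p) ^ k) sums
      ((1 - 1 / of_nat p) * t / of_nat p ^ 2 * (1 / (1 - t / of_nat p)))"
    by (intro sums_mult geometric_sums)
  ultimately show ?thesis by (simp add: sums_unique2)
qed

lemma set_integral_nonroot_cell:
  assumes u: "u \<in> {1..<int p}" and v: "v \<in> {1..<int p}" and uv: "\<not> int p dvd u ^ n + v ^ m"
  shows "(LINT w:ball_Zp p 1 u \<times> ball_Zp p 1 v|(Zp_haar p \<Otimes>\<^sub>M Zp_haar p). abs_powr p s (Zp_binomial p n m w))
    = 1 / of_nat p ^ 2"
proof -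
  let ?H2 = "Zp_haar p \<Otimes>\<^sub>M Zp_haar p"
  have "abs_powr p s (Zp_binomial p n m w) = 1" if "w \<in> ball_Zp p 1 u \<times> ball_Zp p 1 v" for w
  proof -
    have c: "Zp_binomial p n m w \<in> carrier (Zp p)"
      using that by (intro Zp_binomial_closed) (auto simp: ball_Zp_def[OF p_gt_1])
    have "Zp_binomial p n m w (Suc 0) \<noteq> 0"
      using that uv by (auto simp: Zp_binomial_nth_zero_iff ball_Zp_def[OF p_gt_1])
    then show ?thesis using abs_powr_level[OF p_gt_1 c Zp_nth_0[OF p_gt_1 c]] by simp
  qed
  moreover have "measure ?H2 (ball_Zp p 1 u \<times> ball_Zp p 1 v) = 1 / real p ^ 2"
    using u v by (simp add: measure_Zp_pair_Times[OF p_gt_1] ball_Zp_sets_haar[OF p_gt_1]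
        measure_Zp_haar_ball[OF p_gt_1] power2_eq_square)
  ultimately show ?thesis
    by (subst set_integral_eq_const[OF prob_space_Zp_pair[OF p_gt_1]])
       (auto intro!: ball_Zp_sets_haar[OF p_gt_1])
qed

text \<open>By weighted homogeneity the integrand at the scaled point is a constant multiple of the
  original, while the change of variables confines the integral to the image of the scaling. This
  gives the linear equation for the whole integral.\<close>

lemma integral_Zp_binomial_self_similar:
  assumes s: "Re s > 0" and ab: "n * a = m * b"
  defines "Z A \<equiv> LINT w:A|(Zp_haar p \<Otimes>\<^sub>M Zp_haar p). abs_powr p s (Zp_binomial p n m w)"
  shows "(of_nat p powr (- s)) ^ (n * a) * Z (carrier (Zp p) \<times> carrier (Zp p))
    = of_nat p ^ (a + b) * Z (ball_Zp p a 0 \<times> ball_Zp p b 0)"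
proof -
  let ?H2 = "Zp_haar p \<Otimes>\<^sub>M Zp_haar p"
  let ?f = "\<lambda>w. abs_powr p s (Zp_binomial p n m w)"
  have f: "?f \<in> borel_measurable ?H2"
    using integrable_Zp_binomial[OF s] by (rule borel_measurable_integrable)
  have Z: "Z (carrier (Zp p) \<times> carrier (Zp p)) = (LINT w|?H2. ?f w)"
    unfolding Z_def space_Zp_pair[symmetric] by (rule set_integral_space[OF integrable_Zp_binomial[OF s]])
  have "of_nat p ^ (a + b) * Z (ball_Zp p a 0 \<times> ball_Zp p b 0)
      = (LINT w|?H2. ?f (Zp_scale p a (fst w), Zp_scale p b (snd w)))"
    unfolding Z_def by (rule set_integral_Zp_scale[OF p_gt_1 f, symmetric])
  also have "\<dots> = (LINT w|?H2. (of_nat p powr (- s)) ^ (n * a) * ?f w)"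
    by (intro Bochner_Integration.integral_cong)
       (simp_all add: space_Zp_pair Zp_binomial_scale[OF _ ab]
         abs_powr_scale[OF p_gt_1] Zp_binomial_closed)
  finally show ?thesis by (simp add: Z)
qed

end

section \<open>Partition of the plane into cells and summation over them\<close>

context
  fixes p m n :: nat
  assumes prime: "prime p"
begin

abbreviation "unit_cells \<equiv>
  \<Union>c\<in>{1..<int p} \<times> {1..<int p}. ball_Zp p 1 (fst c) \<times> ball_Zp p 1 (snd c)"
text \<open>\<open>Suc (n * i div m)\<close> is the least order of y that makes x^n strictly
  dominate when x has order i. In \<open>y_cell\<close> the roles are exchanged.\<close>

abbreviation "x_cell i \<equiv> Zp_sphere p i \<times> ball_Zp p (Suc (n * i div m)) 0"
abbreviation "y_cell j \<equiv> ball_Zp p (Suc (m * j div n)) 0 \<times> Zp_sphere p j"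

text \<open>Of the (p - 1)^2 unit classes, those in \<open>B\<close> carry the geometric series. On
  each of the others the integrand is 1, and the class contributes its measure p^(-2).\<close>

lemma set_integral_unit_cells:
  assumes s: "Re s > 0" and mn: "\<not> (p dvd m \<and> p dvd n)"
  defines "t \<equiv> of_nat p powr (- s)"
    and "B \<equiv> {(u, v) \<in> {1..<int p} \<times> {1..<int p}. int p dvd u ^ n + v ^ m}"
  shows "(LINT w:unit_cells|(Zp_haar p \<Otimes>\<^sub>M Zp_haar p).
      abs_powr p s (Zp_binomial p n m w))
    = ((of_nat p - 1)\<^sup>2 - of_nat (card B)) / of_nat p ^ 2
      + of_nat (card B) * ((1 - 1 / of_nat p) * t / of_nat p ^ 2 / (1 - t / of_nat p))"
proof -
  note p1 = p_gt_1[OF prime]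
  let ?H2 = "Zp_haar p \<Otimes>\<^sub>M Zp_haar p"
  let ?C = "{1..<int p} \<times> {1..<int p}"
  let ?X = "(1 - 1 / of_nat p) * t / of_nat p ^ 2 / (1 - t / of_nat p)"
  have B: "B \<subseteq> ?C" by (auto simp: B_def)
  have meas: "ball_Zp p 1 u \<times> ball_Zp p 1 v \<in> sets ?H2" for u v
    by (intro pair_measureI ball_Zp_sets_haar[OF p1])
  have "(LINT w:(\<Union>c\<in>?C. ball_Zp p 1 (fst c) \<times> ball_Zp p 1 (snd c))|?H2.
        abs_powr p s (Zp_binomial p n m w))
      = (\<Sum>c\<in>?C. LINT w:ball_Zp p 1 (fst c) \<times> ball_Zp p 1 (snd c)|?H2.
        abs_powr p s (Zp_binomial p n m w))"
    by (intro set_integral_finite_Union set_integrable_Zp_binomial[OF prime s] meas)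
       (auto simp: disjoint_family_on_def ball_Zp_def[OF p1])
  also have "\<dots> = (\<Sum>c\<in>?C. if c \<in> B then ?X else 1 / of_nat p ^ 2)"
  proof (rule sum.cong)
    fix c assume "c \<in> ?C"
    then obtain u v where c: "c = (u, v)" "u \<in> {1..<int p}" "v \<in> {1..<int p}" by blast
    show "(LINT w:ball_Zp p 1 (fst c) \<times> ball_Zp p 1 (snd c)|?H2. abs_powr p s (Zp_binomial p n m w))
        = (if c \<in> B then ?X else 1 / of_nat p ^ 2)"
    proof (cases "int p dvd u ^ n + v ^ m")
      case True
      then show ?thesis
        unfolding c(1) fst_conv snd_conv set_integral_smooth_cell[OF prime s mn c(2,3) True] t_def
        using c by (simp add: B_def)
    next
      case False
      then show ?thesis
        unfolding c(1) fst_conv snd_conv set_integral_nonroot_cell[OF prime c(2,3) False]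
        using c by (simp add: B_def)
    qed
  qed simp
  also have "\<dots> = of_nat (card B) * ?X + of_nat (card (?C - B)) / of_nat p ^ 2"
    using B finite_subset[OF B]
    by (subst sum.If_cases) (simp_all add: Int_absorb1 Diff_eq)
  also have "of_nat (card (?C - B)) = (of_nat p - 1)\<^sup>2 - (of_nat (card B) :: complex)"
  proof -
    have "card (?C - B) = card ?C - card B" using B by (intro card_Diff_subset finite_subset[OF B]) auto
    moreover have "card B \<le> card ?C" using B by (intro card_mono) auto
    moreover have "nat (int p - 1) = p - 1" by simp
    then have "card ?C = (p - 1)\<^sup>2" by (simp add: card_cartesian_product power2_eq_square)
    ultimately show ?thesis using p1 by simp
  qed
  finally show ?thesis by simp
qed

context
  fixes a b :: nat
  assumes m0: "m > 0" and n0: "n > 0" and ab: "a > 0" "b > 0" "n * a = m * b" "coprime a b"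
begin

text \<open>The image of the scaling map; in the application \<open>a\<close> is m/d and
  \<open>b\<close> is n/d.\<close>

abbreviation "corner_cell \<equiv> ball_Zp p a 0 \<times> ball_Zp p b 0"

text \<open>Outside the corner the order i of x is below a or the order j of y is below b. If n i
  and m j differ, one term dominates; if they agree, coprimality of a and b forces i = j = 0, a pair
  of units.\<close>

lemma Zp_pair_decomposition:
  "carrier (Zp p) \<times> carrier (Zp p) =
    corner_cell
    \<union> unit_cells
    \<union> (\<Union>i<a. x_cell i)
    \<union> (\<Union>j<b. y_cell j)"
proof (intro equalityI subsetI)
  note p1 = p_gt_1[OF prime]
  note ball = ball_Zp_def[OF p1]
  fix w assume "w \<in> carrier (Zp p) \<times> carrier (Zp p)"
  then obtain x y where w: "w = (x, y)" and x: "x \<in> carrier (Zp p)" and y: "y \<in> carrier (Zp p)" by blast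
  \<comment> \<open>This bound and its mirror image keep the order of the other variable within the
    finite index ranges.\<close>
  have le_div: "n * i div m < b" if "i < a" for i
  proof -
    have "n * i < m * b" using ab(3) that n0 by (metis nat_mult_less_cancel_disj)
    then show ?thesis using m0 by (simp add: div_less_iff_less_mult mult.commute)
  qed
  have le_div': "m * j div n < a" if "j < b" for j
  proof -
    have "m * j < n * a" using ab(3) that m0 by (metis nat_mult_less_cancel_disj)
    then show ?thesis using n0 by (simp add: div_less_iff_less_mult mult.commute)
  qed
  consider "x a = 0" "y b = 0" | "x a \<noteq> 0" | "x a = 0" "y b \<noteq> 0" by blast
  then show "w \<in> corner_cell \<union> unit_cells \<union> (\<Union>i<a. x_cell i) \<union> (\<Union>j<b. y_cell j)"
  proof cases
    case 1
    then show ?thesis using x y by (simp add: w ball)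
  next
    case 2
    then obtain i where i: "i < a" "x i = 0" "x (Suc i) \<noteq> 0" using ex_level_below[OF p1 x] by blast
    then have xi: "x \<in> Zp_sphere p i" using x by (simp add: Zp_sphere_def)
    show ?thesis
    proof (cases "y (Suc (n * i div m)) = 0")
      case True
      then have "w \<in> x_cell i" using xi y by (simp add: w ball)
      then show ?thesis using i(1) by blast
    next
      case False
      then obtain j where j: "j < Suc (n * i div m)" "y j = 0" "y (Suc j) \<noteq> 0"
        using ex_level_below[OF p1 y] by blast
      then have jb: "j < b" using le_div[OF i(1)] by simp
      have "j * m \<le> n * i" using j(1) m0 by (simp add: less_Suc_eq_le less_eq_div_iff_mult_less_eq)
      then consider "m * j < n * i" | "m * j = n * i" by (auto simp: mult.commute le_less)
      then show ?thesis
      proof cases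
        case 1
        \<comment> \<open>Now y^m dominates, although the case began from the order of x.\<close>
        then have "Suc (m * j div n) \<le> i" using n0 by (simp add: Suc_le_eq div_less_iff_less_mult mult.commute)
        then have "x (Suc (m * j div n)) = 0" using Zp_nth_zero_mono[OF p1 x] i(2) by blast
        then have "w \<in> y_cell j"
          using x y j by (simp add: w ball Zp_sphere_def)
        then show ?thesis using jb by blast
      next
        case 2
        \<comment> \<open>The product of \<open>m * j = n * i\<close> and
          \<open>n * a = m * b\<close>. Cancelling m n gives j a = i b, so a divides i, and i < a
          leaves only i = 0.\<close>
        have "(m * n) * (j * a) = (m * n) * (i * b)"
          using 2 ab(3) by (metis (no_types, lifting) mult.assoc mult.commute mult.left_commute)
        then have "j * a = i * b" using m0 n0 by simp
        then have "a dvd i * b" by (metis dvd_triv_right)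
        then have "a dvd i" using ab(4) by (simp add: coprime_dvd_mult_left_iff)
        then have "i = 0" using i(1) by (auto dest: dvd_imp_le)
        then have "j = 0" using 2 m0 by simp
        have "x 1 \<in> {1..<int p}" "y 1 \<in> {1..<int p}"
          using Zp_bounds[OF p1 x, of 1] Zp_bounds[OF p1 y, of 1] i j \<open>i = 0\<close> \<open>j = 0\<close> by auto
        moreover have "w \<in> ball_Zp p 1 (x 1) \<times> ball_Zp p 1 (y 1)" using x y by (simp add: w ball)
        ultimately show ?thesis by fastforce
      qed
    qed
  next
    case 3
    then obtain j where j: "j < b" "y j = 0" "y (Suc j) \<noteq> 0" using ex_level_below[OF p1 y] by blast
    \<comment> \<open>All residues of x up to level a vanish, and j < b places this level at or
      below a.\<close>
    have "x (Suc (m * j div n)) = 0"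
      using Zp_nth_zero_mono[OF p1 x _ 3(1)] le_div'[OF j(1)] by simp
    then have "w \<in> y_cell j"
      using x y j by (simp add: w ball Zp_sphere_def)
    then show ?thesis using j(1) by blast
  qed
qed (auto simp: ball_Zp_def[OF p_gt_1[OF prime]] Zp_sphere_def)

text \<open>Each pair of cells is separated by orders: a residue vanishing on one cell is nonzero on
  the other. For an \<open>x_cell\<close> and a \<open>y_cell\<close>, a common point would make
  each term dominate the other.\<close>

lemma Zp_pair_decomposition_disjoint:
  "corner_cell \<inter> unit_cells = {}"
  "(corner_cell \<union> unit_cells) \<inter> (\<Union>i<a. x_cell i) = {}"
  "(corner_cell \<union> unit_cells \<union> (\<Union>i<a. x_cell i)) \<inter> (\<Union>j<b. y_cell j) = {}"
proof -
  note p1 = p_gt_1[OF prime]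
  note ball = ball_Zp_def[OF p1]
  have mono: "x j = 0" if "x \<in> ball_Zp p k 0" "j \<le> k" for x j k
    using Zp_nth_zero_mono[OF p1, of x j k] that by (simp add: ball)
  have corner: "fst w i = 0" "snd w j = 0" if "w \<in> corner_cell" "i \<le> a" "j \<le> b" for w i j
    using that mono[of "fst w" a i] mono[of "snd w" b j] by (simp_all only: mem_Times_iff simp_thms)
  have units: "fst w 1 \<noteq> 0" "snd w 1 \<noteq> 0" if "w \<in> unit_cells" for w
    using that by (auto simp: ball)
  have x_cell: "fst w (Suc i) \<noteq> 0" "snd w j = 0" if "w \<in> x_cell i" "j \<le> Suc (n * i div m)" for w i j
  proof -
    have "fst w \<in> Zp_sphere p i" "snd w \<in> ball_Zp p (Suc (n * i div m)) 0"
      using that(1) by (simp_all only: mem_Times_iff)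
    then show "fst w (Suc i) \<noteq> 0" "snd w j = 0" using mono that(2) by (simp_all add: Zp_sphere_def)
  qed
  have y_cell: "fst w i = 0" "snd w (Suc j) \<noteq> 0" if "w \<in> y_cell j" "i \<le> Suc (m * j div n)" for w i j
  proof -
    have "snd w \<in> Zp_sphere p j" "fst w \<in> ball_Zp p (Suc (m * j div n)) 0"
      using that(1) by (simp_all only: mem_Times_iff)
    then show "fst w i = 0" "snd w (Suc j) \<noteq> 0" using mono that(2) by (simp_all add: Zp_sphere_def)
  qed
  have "w \<notin> unit_cells" if "w \<in> corner_cell" for w
    using corner(1)[OF that, of 1 0] units(1)[of w] ab(1) by linarith
  then show "corner_cell \<inter> unit_cells = {}" by blast
  have x_cell_units: "w \<notin> corner_cell \<union> unit_cells" if "w \<in> x_cell i" "i < a" for w i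
  proof -
    have "w \<notin> corner_cell"
    proof
      assume "w \<in> corner_cell"
      then have "fst w (Suc i) = 0" using that(2) by (rule corner(1)[OF _ Suc_leI le0])
      then show False using x_cell(1)[OF that(1) le0] by contradiction
    qed
    moreover have "w \<notin> unit_cells"
    proof
      assume "w \<in> unit_cells"
      moreover have "snd w 1 = 0" by (rule x_cell(2)[OF that(1)]) simp
      ultimately show False using units(2) by blast
    qed
    ultimately show ?thesis by blast
  qed
  then show "(corner_cell \<union> unit_cells) \<inter> (\<Union>i<a. x_cell i) = {}" by blast
  have y_cell_units: "w \<notin> corner_cell \<union> unit_cells" if "w \<in> y_cell j" "j < b" for w j
  proof -
    have "w \<notin> corner_cell"
    proof
      assume "w \<in> corner_cell"
      then have "snd w (Suc j) = 0" using that(2) by (rule corner(2)[OF _ le0 Suc_leI])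
      then show False using y_cell(2)[OF that(1) le0] by contradiction
    qed
    moreover have "w \<notin> unit_cells"
    proof
      assume "w \<in> unit_cells"
      moreover have "fst w 1 = 0" by (rule y_cell(1)[OF that(1)]) simp
      ultimately show False using units(1) by blast
    qed
    ultimately show ?thesis by blast
  qed
  have x_y_cell: False if w: "w \<in> x_cell i" "w \<in> y_cell j" for w i j
  proof -
    \<comment> \<open>The residue of y at level \<open>Suc j\<close> is nonzero, while those up to
      \<open>Suc (n * i div m)\<close> vanish. This yields n i < m j, and the mirror argument yields
      the reverse.\<close>
    have "\<not> Suc j \<le> Suc (n * i div m)" using x_cell(2)[OF w(1)] y_cell(2)[OF w(2) le0] by blast
    moreover have "\<not> Suc i \<le> Suc (m * j div n)" using y_cell(1)[OF w(2)] x_cell(1)[OF w(1) le0] by blast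
    ultimately have "n * i div m < j" "m * j div n < i" by simp_all
    then have "n * i < j * m" "m * j < i * n"
      using m0 n0 by (simp_all only: div_less_iff_less_mult)
    then show False by (simp add: mult.commute)
  qed
  have disj: "(A \<union> (\<Union>i<a. X i)) \<inter> (\<Union>j<b. Y j) = {}"
    if "\<And>w j. w \<in> Y j \<Longrightarrow> j < b \<Longrightarrow> w \<notin> A" "\<And>w i j. w \<in> X i \<Longrightarrow> w \<in> Y j \<Longrightarrow> False"
    for A :: "((nat \<Rightarrow> int) \<times> (nat \<Rightarrow> int)) set" and X Y
    using that by blast
  show "(corner_cell \<union> unit_cells \<union> (\<Union>i<a. x_cell i)) \<inter> (\<Union>j<b. y_cell j) = {}"
    by (rule disj[OF y_cell_units x_y_cell])
qed

text \<open>Additivity over the partition. Cells of the same family are disjoint because the order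
  that indexes them is unique.\<close>

lemma integral_Zp_binomial_decomposition:
  assumes s: "Re s > 0"
  defines "t \<equiv> of_nat p powr (- s)"
    and "Z A \<equiv> LINT w:A|(Zp_haar p \<Otimes>\<^sub>M Zp_haar p). abs_powr p s (Zp_binomial p n m w)"
  shows "Z (carrier (Zp p) \<times> carrier (Zp p)) =
    Z corner_cell
    + Z unit_cells
    + (\<Sum>i<a. (1 - 1 / of_nat p) * (1 / of_nat p) * (t ^ (n * i) / of_nat p ^ (n * i div m + i)))
    + (\<Sum>j<b. (1 - 1 / of_nat p) * (1 / of_nat p) * (t ^ (m * j) / of_nat p ^ (m * j div n + j)))"
proof -
  note p1 = p_gt_1[OF prime]
  let ?H2 = "Zp_haar p \<Otimes>\<^sub>M Zp_haar p"
  note sets = pair_measureI[OF ball_Zp_sets_haar[OF p1] ball_Zp_sets_haar[OF p1]]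
  have P: "x_cell i \<in> sets ?H2" and Q: "y_cell i \<in> sets ?H2" for i
    by (intro pair_measureI Zp_sphere_sets[OF prime] ball_Zp_sets_haar[OF p1])+
  have U: "unit_cells \<in> sets ?H2" by (intro sets.finite_UN sets) simp
  have PU: "(\<Union>i<a. x_cell i) \<in> sets ?H2" and QU: "(\<Union>j<b. y_cell j) \<in> sets ?H2"
    by (intro sets.finite_UN P Q; simp)+
  note int = set_integrable_Zp_binomial[OF prime s]
  have "Z (carrier (Zp p) \<times> carrier (Zp p))
      = Z (corner_cell \<union> unit_cells \<union> (\<Union>i<a. x_cell i)) + Z (\<Union>j<b. y_cell j)"
    unfolding Zp_pair_decomposition Z_def
    by (intro set_integral_Un int sets.Un sets U PU QU Zp_pair_decomposition_disjoint)
  also have "Z (corner_cell \<union> unit_cells \<union> (\<Union>i<a. x_cell i))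
      = Z (corner_cell \<union> unit_cells) + Z (\<Union>i<a. x_cell i)"
    unfolding Z_def by (intro set_integral_Un int sets.Un sets U PU Zp_pair_decomposition_disjoint)
  also have "Z (corner_cell \<union> unit_cells) = Z corner_cell + Z unit_cells"
    unfolding Z_def by (intro set_integral_Un int sets U Zp_pair_decomposition_disjoint)
  also have "Z (\<Union>i<a. x_cell i) = (\<Sum>i<a. Z (x_cell i))"
    unfolding Z_def using level_unique[OF p1]
    by (intro set_integral_finite_Union int P) (auto simp: disjoint_family_on_def Zp_sphere_def)
  also have "Z (\<Union>j<b. y_cell j) = (\<Sum>j<b. Z (y_cell j))"
    unfolding Z_def using level_unique[OF p1]
    by (intro set_integral_finite_Union int Q) (auto simp: disjoint_family_on_def Zp_sphere_def)
  finally show ?thesis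
    unfolding Z_def t_def set_integral_dominant_x[OF prime m0 n0] set_integral_dominant_y[OF prime m0 n0] .
qed

end

end

section \<open>Solving the self-similarity equation for the integral\<close>

theorem mainTheorem1:
  fixes p m n d N :: nat and s t :: complex
  assumes "prime p" and "m > 0" and "n > 0"
    and "\<not> (p dvd m \<and> p dvd n)"
    and "Re s > 0"
  defines "d \<equiv> gcd m n"
    and "N \<equiv> card {(x, y). x \<in> carrier (residue_ring (int p)) \<and> y \<in> carrier (residue_ring (int p)) \<and>
               x [^]\<^bsub>residue_ring (int p)\<^esub> n \<oplus>\<^bsub>residue_ring (int p)\<^esub> y [^]\<^bsub>residue_ring (int p)\<^esub> m
                 = \<zero>\<^bsub>residue_ring (int p)\<^esub>}"
    and "t \<equiv> of_nat p powr (- s)"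
  shows "has_bochner_integral (Zp_haar p \<Otimes>\<^sub>M Zp_haar p)
    (\<lambda>(x, y). complex_of_real (padic_abs p (x [^]\<^bsub>Zp p\<^esub> n \<oplus>\<^bsub>Zp p\<^esub> y [^]\<^bsub>Zp p\<^esub> m)) powr s)
    ((1 - 1 / of_nat p) * (1 / of_nat p) /
       (1 - of_nat p powi (- int ((m + n) div d)) * t ^ (m * n div d)) *
       ((\<Sum>j<n div d. of_nat p powi (- \<lfloor>real (j * m) / real n\<rfloor> - int j) * t ^ (m * j)) +
        (\<Sum>j<m div d. of_nat p powi (- \<lfloor>real (j * n) / real m\<rfloor> - int j) * t ^ (n * j)))
     + (((of_nat p - 1)\<^sup>2 - (of_nat N - 1)) * of_nat p powi (- 2) * (1 - 1 / of_nat p * t)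
        + (of_nat N - 1) * ((of_nat p)\<^sup>2 - of_nat p) * of_nat p powi (- 4) * t) /
       ((1 - 1 / of_nat p * t) *
        (1 - of_nat p powi (- int ((m + n) div d)) * t ^ (m * n div d))))"
proof -
  note prime = \<open>prime p\<close> and m0 = \<open>m > 0\<close> and n0 = \<open>n > 0\<close> and s = \<open>Re s > 0\<close>
  note p1 = prime_gt_1_nat[OF prime]
  \<comment> \<open>The exponents for scaling x and y: the least positive solution of
    \<open>n * a = m * b\<close>, whose common value is the lcm of m and n.\<close>
  define a where "a = m div d"
  define b where "b = n div d"
  have d0: "d > 0" using m0 by (simp add: d_def)
  have dm: "m = d * a" and dn: "n = d * b" by (simp_all add: a_def b_def d_def)
  have ab: "a > 0" "b > 0" "n * a = m * b" "coprime a b"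
    using m0 n0 d0 by (auto simp: dm dn) (simp add: a_def b_def d_def div_gcd_coprime)
  have sum_div: "(m + n) div d = a + b" and prod_div: "m * n div d = n * a"
    using d0 by (simp_all add: dm dn distrib_left[symmetric])
  let ?H2 = "Zp_haar p \<Otimes>\<^sub>M Zp_haar p"
  let ?f = "\<lambda>w. abs_powr p s (Zp_binomial p n m w)"
  define P where "P = (of_nat p :: complex)"
  define Z where "Z A = (LINT w:A|?H2. ?f w)" for A
  define Z0 where "Z0 = Z (carrier (Zp p) \<times> carrier (Zp p))"
  define K where "K = (1 - 1 / P) * (1 / P)"
  \<comment> \<open>\<open>S1\<close> collects the cells where y^m dominates, \<open>S2\<close>
    those where x^n does.\<close>
  define S1 where "S1 = (\<Sum>j<b. P powi (- \<lfloor>real (j * m) / real n\<rfloor> - int j) * t ^ (m * j))"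
  define S2 where "S2 = (\<Sum>j<a. P powi (- \<lfloor>real (j * n) / real m\<rfloor> - int j) * t ^ (n * j))"
  define I where "I = Z (\<Union>c\<in>{1..<int p} \<times> {1..<int p}. ball_Zp p 1 (fst c) \<times> ball_Zp p 1 (snd c))"
  have P0: "P \<noteq> 0" using p1 by (simp add: P_def)
  have nP: "norm P > 1" using p1 by (simp add: P_def)
  have nt: "norm t < 1" unfolding t_def by (rule norm_powr_neg_less_1[OF p1 s])
  have q: "P powi (- int k) = 1 / P ^ k" for k
    by (simp add: power_int_minus divide_inverse)
  have powi: "P powi (- \<lfloor>real (j * i) / real k\<rfloor> - int j) = 1 / P ^ (i * j div k + j)" for i j k
  proof -
    have "\<lfloor>real (j * i) / real k\<rfloor> = int (i * j div k)"
      by (simp add: floor_divide_of_nat_eq mult.commute del: of_nat_mult)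
    then have "- \<lfloor>real (j * i) / real k\<rfloor> - int j = - int (i * j div k + j)" by simp
    then show ?thesis by (simp only: q)
  qed
  have S2: "(\<Sum>i<a. K * (t ^ (n * i) / P ^ (n * i div m + i))) = K * S2"
    unfolding S2_def powi sum_distrib_left by simp
  have S1: "(\<Sum>j<b. K * (t ^ (m * j) / P ^ (m * j div n + j))) = K * S1"
    unfolding S1_def powi sum_distrib_left by simp
  \<comment> \<open>The number of root classes of units.\<close>
  define M where "M = (of_nat N - 1 :: complex)"
  have I: "I = ((P - 1)\<^sup>2 - M) / P ^ 2 + M * ((1 - 1 / P) * t / P ^ 2 / (1 - t / P))"
  proof -
    have "N = Suc (card {(u, v) \<in> {1..<int p} \<times> {1..<int p}. int p dvd u ^ n + v ^ m})"
      unfolding N_def by (rule card_unit_solutions[OF prime m0 n0])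
    then have "M = of_nat (card {(u, v) \<in> {1..<int p} \<times> {1..<int p}. int p dvd u ^ n + v ^ m})"
      by (simp add: M_def)
    then show ?thesis
      unfolding I_def Z_def P_def t_def
      using set_integral_unit_cells[OF prime s \<open>\<not> (p dvd m \<and> p dvd n)\<close>] by simp
  qed
  have dec: "Z0 = Z (ball_Zp p a 0 \<times> ball_Zp p b 0) + I + K * S2 + K * S1"
    unfolding S1[symmetric] S2[symmetric]
    unfolding Z0_def Z_def I_def K_def P_def t_def
    by (rule integral_Zp_binomial_decomposition[OF prime m0 n0 ab s])
  have self: "t ^ (n * a) * Z0 = P ^ (a + b) * Z (ball_Zp p a 0 \<times> ball_Zp p b 0)"
    unfolding Z0_def Z_def P_def t_def
    by (rule integral_Zp_binomial_self_similar[OF prime s ab(3)])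
  define D where "D = 1 - P powi (- int (a + b)) * t ^ (n * a)"
  \<comment> \<open>Self-similarity makes the corner integral a multiple of \<open>Z0\<close>;
    moving it to the left produces the factor \<open>D\<close>.\<close>
  have D: "D * Z0 = I + K * (S1 + S2)"
  proof -
    have "Z (ball_Zp p a 0 \<times> ball_Zp p b 0) = P powi (- int (a + b)) * t ^ (n * a) * Z0"
      using self P0 unfolding q by (simp add: field_simps)
    then show ?thesis using dec by (simp add: D_def algebra_simps)
  qed
  \<comment> \<open>\<open>D\<close> could vanish only if t^(n a) = p^(a+b), but the left side has
    norm below 1 and the right side norm at least 1.\<close>
  have D0: "D \<noteq> 0"
  proof -
    have "norm (t ^ (n * a)) < 1"
      using nt n0 ab(1) by (simp add: norm_power power_less_one_iff)
    also have "1 \<le> norm (P ^ (a + b))" using nP by (simp add: norm_power)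
    finally have "t ^ (n * a) \<noteq> P ^ (a + b)" by auto
    then show ?thesis using P0 unfolding D_def q by simp
  qed
  have tP: "1 - t / P \<noteq> 0" using nt nP P0 by auto
  have "Z0 = K / D * (S1 + S2) + I / D"
    using D D0 by (simp add: field_simps)
  also have "I = (((P - 1)\<^sup>2 - M) * P powi (- 2) * (1 - 1 / P * t)
      + M * (P\<^sup>2 - P) * P powi (- 4) * t) / (1 - 1 / P * t)"
  proof -
    have 2: "P powi (- 2) = 1 / P ^ 2" using q[of 2] by simp
    \<comment> \<open>This identifies the constant of the stated formula with the leading
      coefficient of the geometric series on a root class.\<close>
    have "(P\<^sup>2 - P) * P powi (- 4) = (1 - 1 / P) / P ^ 2"
      using P0 q[of 4] by (simp add: field_simps power2_eq_square power4_eq_xxxx)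
    then have 4: "M * (P\<^sup>2 - P) * P powi (- 4) * t = M * ((1 - 1 / P) / P ^ 2) * t"
      by (metis mult.assoc)
    show ?thesis
      using tP unfolding I 2 4 by (simp add: add_divide_distrib)
  qed
  finally have Z0: "Z0 = K / D * (S1 + S2) +
      (((P - 1)\<^sup>2 - M) * P powi (- 2) * (1 - 1 / P * t)
      + M * (P\<^sup>2 - P) * P powi (- 4) * t) / ((1 - 1 / P * t) * D)"
    by simp
  have int: "integrable ?H2 ?f" by (rule integrable_Zp_binomial[OF prime s])
  have "Z0 = integral\<^sup>L ?H2 ?f"
    unfolding Z0_def Z_def space_Zp_pair[OF prime, symmetric] by (rule set_integral_space[OF int])
  then have "has_bochner_integral ?H2 ?f Z0" using int by (simp add: has_bochner_integral_iff)
  then show ?thesis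
    unfolding Z0 K_def S1_def S2_def D_def M_def P_def a_def[symmetric] b_def[symmetric] sum_div prod_div
    by (simp only: abs_powr_def Zp_binomial_def case_prod_beta')
qed

end
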